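(* Let $\beta\in(0,1)$, $\alpha>0$, $\lambda<0$ and $u_0>0$. Then there exists a constant $C>1$ such that the solution $u$ to $$\partial_0^\beta u(x)=\lambda x^{\alpha-\beta}u(x)\ \text{ for }x>0,\qquad u(0)=u_0,$$ satisfies $$\frac{C^{-1}}{x^{1+\alpha}}\le u(x)\le\frac{C}{x^{1+\alpha}}\quad\text{for all }x\ge1.$$
   Context: Fix $\beta\in(0,1)$. For $0<T<\infty$, $C\cap L^1(0,T]$ is the set of continuous, Lebesgue integrable real functions on $(0,T]$. For $u\in C\cap L^1(0,T]$, $J_0^{1-\beta}u(x)=\int_0^x\frac{(x-r)^{-\beta}}{\Gamma(1-\beta)}u(r)\,dr$. Define $C_\beta(0,T]=\{u\in C\cap L^1(0,T]: J_0^{1-\beta}u\in C^1(0,T]\}$ and $C_\beta[0,T]=C[0,T]\cap C_\beta(0,T]$. For $u\in C_\beta(0,T]$, the censored fractional derivative is $\partial_0^\beta u(x)=\frac{d}{dx}J_0^{1-\beta}u(x)-\frac{x^{-\beta}}{\Gamma(1-\beta)}u(x)$, $x\in(0,T]$. "The solution" is the function $u$ on $[0,\infty)$ whose restriction to $[0,T]$ is, for every $T>0$, the unique element of $C_\beta[0,T]$ solving the problem on $(0,T]$; explicitly, it is $$u(x)=u_0\sum_{N=0}^\infty(\lambda x^{\alpha})^N\prod_{n=1}^N\left(\frac{\Gamma(1+n\alpha)}{\Gamma(n\alpha+1-\beta)}-\frac{1}{\Gamma(1-\beta)}\right)^{-1}$$ (empty product equal to $1$). *)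

theory Defs
  imports "HOL-Analysis.Analysis"
begin

text \<open>A real function on \<open>(0,T]\<close> or \<open>[0,T]\<close> is represented by a total function of type
  \<open>real \<Rightarrow> real\<close>; none of the notions below depend on its values outside that interval.
  In particular derivatives are taken within \<open>(0,T]\<close>, hence are one-sided at \<open>T\<close>.\<close>

definition C_L1 :: "real \<Rightarrow> (real \<Rightarrow> real) set" where
  "C_L1 T = {u. continuous_on {0<..T} u \<and> set_integrable lborel {0<..T} u}"

definition C1_on :: "real \<Rightarrow> (real \<Rightarrow> real) set" where
  "C1_on T = {f. \<exists>f'. continuous_on {0<..T} f' \<and>
     (\<forall>x\<in>{0<..T}. (f has_vector_derivative f' x) (at x within {0<..T}))}"

text \<open>\<open>RL_J \<beta>\<close> is the Riemann--Liouville integral of order \<open>1 - \<beta>\<close>.\<close>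

definition RL_J :: "real \<Rightarrow> (real \<Rightarrow> real) \<Rightarrow> real \<Rightarrow> real" where
  "RL_J \<beta> u x = (LINT r:{0<..x}|lborel. (x - r) powr (- \<beta>) / Gamma (1 - \<beta>) * u r)"

definition C_beta_open :: "real \<Rightarrow> real \<Rightarrow> (real \<Rightarrow> real) set" where
  "C_beta_open \<beta> T = {u \<in> C_L1 T. RL_J \<beta> u \<in> C1_on T}"

definition C_beta_closed :: "real \<Rightarrow> real \<Rightarrow> (real \<Rightarrow> real) set" where
  "C_beta_closed \<beta> T = {u. continuous_on {0..T} u} \<inter> C_beta_open \<beta> T"

definition censored_deriv :: "real \<Rightarrow> real \<Rightarrow> (real \<Rightarrow> real) \<Rightarrow> real \<Rightarrow> real" where
  "censored_deriv \<beta> T u x =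
     vector_derivative (RL_J \<beta> u) (at x within {0<..T})
       - x powr (- \<beta>) / Gamma (1 - \<beta>) * u x"

definition solves_on ::
  "real \<Rightarrow> real \<Rightarrow> real \<Rightarrow> real \<Rightarrow> real \<Rightarrow> (real \<Rightarrow> real) \<Rightarrow> bool" where
  "solves_on \<beta> \<alpha> lam u0 T u \<longleftrightarrow>
     u \<in> C_beta_closed \<beta> T \<and> u 0 = u0 \<and>
     (\<forall>x\<in>{0<..T}. censored_deriv \<beta> T u x = lam * x powr (\<alpha> - \<beta>) * u x)"

text \<open>Solutions on \<open>[0,\<infinity>)\<close>; values at negative arguments are unconstrained.\<close>

definition solves ::
  "real \<Rightarrow> real \<Rightarrow> real \<Rightarrow> real \<Rightarrow> (real \<Rightarrow> real) \<Rightarrow> bool" where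
  "solves \<beta> \<alpha> lam u0 u \<longleftrightarrow> (\<forall>T>0. solves_on \<beta> \<alpha> lam u0 T u)"

end

(* With J = J_0^(1-beta) u and U(x) the integral of u over (0,x], the equation reads
   J'(x) = x^(-beta) (1/Gamma(1-beta) + lam x^alpha) u(x).

   A function w whose fractional integral of order 1-beta is C^1 is itself a fractional integral of
   order beta of a continuous function, hence w(x0-h) - w(x0) = o(h^beta).  So at a point x0 where w
   attains a running minimum the censored derivative is nonpositive, which gives a comparison
   principle: solutions are unique and nonnegative, and comparing u with its dilates u(kx), k > 1,
   shows that u is decreasing.

   For decreasing u, J(x) lies between two multiples of x^(-beta) U(x).  Since J >= 0, the mean value
   theorem for J on [x,2x] gives u(2x) <= K x^(-1-alpha) U(x), so U is bounded by Gronwall's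
   argument and the upper bound follows; applied on [x,Mx] with M large it gives the lower bound. *)

theory Submission
  imports Defs
begin

section \<open>Weakly singular integrals\<close>

text \<open>The order o(h^beta) is exactly what replaces it: on the last piece (x0 - h, x0] it
  cancels the kernel (x0 - r)^(-beta) and leaves an arbitrarily small multiple of h, too little for
  a positive derivative. The comparison lemma is stated for general pairs w, k rather than for
  solutions, because dilates solve an equation with a different coefficient. The rate comes from a
  balance: over [x,2x] the drop of J is of size x * x^(alpha-beta) * u, while J itself is of size
  x^(-beta) * U, hence u is of size x^(-1-alpha) * U. As x^(-1-alpha) is integrable at infinity,
  this inequality for U' = u bounds U instead of letting it grow. The lower bound depends on that
  boundedness: without it J(Mx) need not be small compared with J(x).\<close>

lemma continuous_on_Icc_bounded:
  fixes w :: "real \<Rightarrow> real"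
  assumes "continuous_on {y..z} w"
  obtains B where "\<And>r. r \<in> {y..z} \<Longrightarrow> \<bar>w r\<bar> \<le> B"
proof -
  have "bounded (w ` {y..z})"
    using assms compact_continuous_image compact_imp_bounded by blast
  then show ?thesis using that unfolding bounded_iff by (metis image_eqI real_norm_def)
qed

lemma set_integrable_mult_continuous:
  fixes f w :: "real \<Rightarrow> real"
  assumes "set_integrable lborel {y<..z} f" "continuous_on {y..z} w"
  shows "set_integrable lborel {y<..z} (\<lambda>r. f r * w r)"
proof -
  obtain B where B: "\<And>r. r \<in> {y..z} \<Longrightarrow> \<bar>w r\<bar> \<le> B"
    using continuous_on_Icc_bounded[OF assms(2)] by blast
  have wm: "set_borel_measurable lborel {y<..z} w"
  proof -
    have "continuous_on {y<..z} w" using assms(2) by (rule continuous_on_subset) auto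
    then show ?thesis using set_measurable_continuous_on[of "{y<..z}" w]
      by (simp add: set_borel_measurable_def)
  qed
  have "set_integrable lborel {y<..z} (\<lambda>r. B * f r)"
    using assms(1) by simp
  moreover have "set_borel_measurable lborel {y<..z} (\<lambda>r. f r * w r)"
  proof -
    have "(\<lambda>r. (indicator {y<..z} r *\<^sub>R f r) * (indicator {y<..z} r *\<^sub>R w r)) \<in> borel_measurable lborel"
      using assms(1) wm unfolding set_integrable_def set_borel_measurable_def
      by (intro borel_measurable_times) auto
    also have "(\<lambda>r. (indicator {y<..z} r *\<^sub>R f r) * (indicator {y<..z} r *\<^sub>R w r)) = (\<lambda>r. indicator {y<..z} r *\<^sub>R (f r * w r))"
      by (auto simp: fun_eq_iff indicator_def)
    finally show ?thesis unfolding set_borel_measurable_def .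
  qed
  moreover have "AE r in lborel. r \<in> {y<..z} \<longrightarrow> norm (f r * w r) \<le> norm (B * f r)"
  proof (intro AE_I2 impI)
    fix r assume "r \<in> {y<..z}"
    then have "\<bar>w r\<bar> \<le> B" using B by auto
    then have "\<bar>w r\<bar> \<le> \<bar>B\<bar>" by linarith
    then show "norm (f r * w r) \<le> norm (B * f r)"
      using mult_right_mono[of "\<bar>w r\<bar>" "\<bar>B\<bar>" "\<bar>f r\<bar>"] by (simp add: abs_mult mult.commute)
  qed
  ultimately show ?thesis by (rule set_integrable_bound)
qed

text \<open>Euler's Beta integral after the affine change \<open>s = r + (x - r) * t\<close>. The
  Bochner form gives integrability and value together; the power kernels below are special
  cases.\<close>

lemma has_bochner_integral_Beta_kernel:
  fixes a b r x :: real
  assumes "a > 0" "b > 0" "r < x"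
  shows "has_bochner_integral lborel
    (\<lambda>s. indicator {r<..x} s *\<^sub>R ((x - s) powr (a - 1) * (s - r) powr (b - 1)))
    ((x - r) powr (a + b - 1) * Beta a b)"
proof -
  define F where "F = (\<lambda>t::real. indicator {0<..1} t *\<^sub>R (t powr (b - 1) * (1 - t) powr (a - 1)))"
  have "integral\<^sup>N lborel (\<lambda>t. ennreal (t powr (b - 1) * (1 - t) powr (a - 1)) * indicator {0..1} t) = ennreal (Beta b a)"
    using has_integral_Beta_real[OF assms(2,1)] by (intro nn_integral_has_integral_lebesgue') auto
  \<comment> \<open>Since \<open>0 powr p = 0\<close>, the integrand vanishes at
    \<open>t = 0\<close>, so the closed and the half-open indicator give the same function
    pointwise.\<close>
  also have "(\<lambda>t. ennreal (t powr (b - 1) * (1 - t) powr (a - 1)) * indicator {0..1} t) = (\<lambda>t. ennreal (F t))"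
    by (auto simp: fun_eq_iff F_def indicator_def)
  finally have "integral\<^sup>N lborel (\<lambda>t. ennreal (F t)) = ennreal (Beta b a)" .
  moreover have "0 \<le> Beta b a" using assms by (simp add: Beta_def Gamma_real_nonneg)
  ultimately have "has_bochner_integral lborel F (Beta b a)"
    by (intro has_bochner_integral_nn_integral) (auto simp: F_def)
  moreover have affine: "- r / (x - r) + (1 / (x - r)) * s = (s - r) / (x - r)" for s
    by (simp add: diff_divide_distrib)
  ultimately have "has_bochner_integral lborel (\<lambda>s. F (- r / (x - r) + (1 / (x - r)) * s)) (Beta b a /\<^sub>R \<bar>1 / (x - r)\<bar>)"
    using assms by (subst lborel_has_bochner_integral_real_affine_iff[symmetric]) auto
  then have "has_bochner_integral lborel (\<lambda>s. F ((s - r) / (x - r))) (Beta b a * (x - r))"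
    using assms unfolding affine by (simp add: mult.commute)
  then have *: "has_bochner_integral lborel (\<lambda>s. (x - r) powr (a + b - 2) * F ((s - r) / (x - r)))
      ((x - r) powr (a + b - 2) * (Beta b a * (x - r)))"
    using assms by (intro has_bochner_integral_mult_right) simp
  have "(\<lambda>s. (x - r) powr (a + b - 2) * F ((s - r) / (x - r))) =
    (\<lambda>s. indicator {r<..x} s *\<^sub>R ((x - s) powr (a - 1) * (s - r) powr (b - 1)))"
  proof
    fix s
    show "(x - r) powr (a + b - 2) * F ((s - r) / (x - r)) =
      indicator {r<..x} s *\<^sub>R ((x - s) powr (a - 1) * (s - r) powr (b - 1))"
    proof (cases "s \<in> {r<..x}")
      case True
      then have "0 < (s - r) / (x - r)" "(s - r) / (x - r) \<le> 1" using assms by auto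
      then have "F ((s - r) / (x - r)) = ((s - r) / (x - r)) powr (b - 1) * (1 - (s - r) / (x - r)) powr (a - 1)"
        by (simp add: F_def)
      also have "1 - (s - r) / (x - r) = (x - s) / (x - r)" using assms by (simp add: field_simps)
      also have "((s - r) / (x - r)) powr (b - 1) * ((x - s) / (x - r)) powr (a - 1) =
        (s - r) powr (b - 1) * (x - s) powr (a - 1) / ((x - r) powr (b - 1) * (x - r) powr (a - 1))"
        using True assms by (simp add: powr_divide)
      also have "(x - r) powr (b - 1) * (x - r) powr (a - 1) = (x - r) powr (a + b - 2)"
        by (simp add: powr_add[symmetric] algebra_simps)
      finally show ?thesis using True assms by (simp add: field_simps)
    next
      case False
      then have "(s - r) / (x - r) \<le> 0 \<or> (s - r) / (x - r) > 1" using assms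
        by (auto simp: field_simps)
      then show ?thesis using False by (auto simp: F_def)
    qed
  qed
  moreover have "(x - r) powr (a + b - 2) * (Beta b a * (x - r)) = (x - r) powr (a + b - 1) * Beta a b"
    using assms powr_add[of "x - r" "a + b - 2" 1] by (simp add: Beta_commute)
  ultimately show ?thesis using * by simp
qed

lemma Beta_real_1:
  fixes a :: real
  assumes "a > 0"
  shows "Beta a 1 = 1 / a"
proof -
  have "Gamma (a + 1) = a * Gamma a" "Gamma a > 0"
    using assms by (auto intro!: Gamma_plus1 Gamma_real_pos elim: nonpos_Ints_cases)
  then show ?thesis by (simp add: Beta_def)
qed

lemma power_kernel:
  fixes a y z :: real
  assumes "a > 0" "y \<le> z"
  shows "set_integrable lborel {y<..z} (\<lambda>r. (z - r) powr (a - 1))"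
    and "(LINT r:{y<..z}|lborel. (z - r) powr (a - 1)) = (z - y) powr a / a"
proof -
  have "has_bochner_integral lborel (\<lambda>s. indicator {y<..z} s *\<^sub>R ((z - s) powr (a - 1))) ((z - y) powr a / a)"
  proof (cases "y = z")
    case False
    then have "y < z" using assms by simp
    moreover have "(\<lambda>s. indicator {y<..z} s *\<^sub>R ((z - s) powr (a - 1) * (s - y) powr (1 - 1))) =
      (\<lambda>s. indicator {y<..z} s *\<^sub>R ((z - s) powr (a - 1)))"
      by (auto simp: fun_eq_iff indicator_def)
    ultimately show ?thesis
      using has_bochner_integral_Beta_kernel[OF assms(1), of 1 y z] Beta_real_1[OF assms(1)] by simp
  qed (simp add: has_bochner_integral_zero)
  then show "set_integrable lborel {y<..z} (\<lambda>r. (z - r) powr (a - 1))"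
    and "(LINT r:{y<..z}|lborel. (z - r) powr (a - 1)) = (z - y) powr a / a"
    by (auto simp: set_integrable_def set_lebesgue_integral_def has_bochner_integral_iff)
qed

section \<open>Riemann-Liouville integrals of arbitrary order: semigroup law, scaling, integrable
  powers\<close>

definition RL :: "real \<Rightarrow> (real \<Rightarrow> real) \<Rightarrow> real \<Rightarrow> real" where
  "RL a f x = (LINT r:{0<..x}|lborel. (x - r) powr (a - 1) / Gamma a * f r)"

lemma RL_J_eq_RL: "RL_J \<beta> = RL (1 - \<beta>)"
  by (simp add: RL_J_def RL_def fun_eq_iff)

text \<open>Fubini on the triangle \<open>0 < r < s \<le> x\<close>; the inner integral in
  \<open>s\<close> is a Beta integral. With \<open>a + b \<ge> 1\<close> the composed kernel is
  bounded on the interval, so integrability of \<open>f\<close> alone suffices.\<close>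

lemma RL_semigroup:
  assumes "a > 0" "b > 0" "a + b \<ge> 1" and f: "set_integrable lborel {0<..x} f"
  shows "RL a (RL b f) x = RL (a + b) f x"
proof -
  define f' where "f' = (\<lambda>r. indicator {0<..x} r * f r)"
  define H where "H = (\<lambda>r s. if 0 < r \<and> r < s \<and> s \<le> x then
      (x - s) powr (a - 1) * (s - r) powr (b - 1) / (Gamma a * Gamma b) * f' r else 0)"
  have G: "Gamma a > 0" "Gamma b > 0" "Gamma (a + b) > 0" using assms by (auto intro: Gamma_real_pos)
  have f'm[measurable]: "f' \<in> borel_measurable borel" and f'i: "integrable lborel f'"
    using f unfolding f'_def set_integrable_def by (auto dest: borel_measurable_integrable)
  have Hm[measurable]: "case_prod H \<in> borel_measurable (lborel \<Otimes>\<^sub>M lborel)"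
    unfolding H_def by measurable
  define P where "P = (\<lambda>r. (x - r) powr (a + b - 1) / Gamma (a + b))"
  have inner: "has_bochner_integral lborel (\<lambda>s. H r s) (P r * f' r)" for r
  proof (cases "0 < r \<and> r < x")
    case True
    have "has_bochner_integral lborel
      (\<lambda>s. (f' r / (Gamma a * Gamma b)) * indicator {r<..x} s *\<^sub>R ((x - s) powr (a - 1) * (s - r) powr (b - 1)))
      ((f' r / (Gamma a * Gamma b)) * ((x - r) powr (a + b - 1) * Beta a b))"
      using True assms has_bochner_integral_mult_right[OF has_bochner_integral_Beta_kernel[of a b r x], where c="f' r / (Gamma a * Gamma b)"]
      by (simp add: mult.assoc)
    moreover have "(\<lambda>s. (f' r / (Gamma a * Gamma b)) * indicator {r<..x} s *\<^sub>R ((x - s) powr (a - 1) * (s - r) powr (b - 1))) = H r"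
      using True by (auto simp: H_def fun_eq_iff indicator_def)
    ultimately show ?thesis using G by (simp add: Beta_def P_def field_simps)
  next
    case False
    have "H r s = 0" for s using False by (auto simp: H_def)
    have "P r * f' r = 0" using False by (auto simp: P_def f'_def indicator_def)
    moreover have "H r = (\<lambda>s. 0)" using \<open>\<And>s. H r s = 0\<close> by auto
    ultimately show ?thesis using has_bochner_integral_zero[of lborel] by metis
  qed
  \<comment> \<open>\<open>H r s\<close> has the sign of \<open>f' r\<close> for every
    \<open>s\<close>, so the absolute integral required by Fubini follows from \<open>inner\<close>
    by a factor \<open>sgn (f' r)\<close>.\<close>
  have inner_norm: "(\<integral>s. norm (H r s) \<partial>lborel) = norm (P r * f' r)" for r
  proof -
    have "norm (H r s) = sgn (f' r) * H r s" for s
      using G by (auto simp: H_def abs_mult sgn_if)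
    then have "(\<integral>s. norm (H r s) \<partial>lborel) = sgn (f' r) * (P r * f' r)"
      using inner[of r] by (simp add: has_bochner_integral_iff)
    also have "\<dots> = norm (P r * f' r)"
      using G by (auto simp: P_def abs_mult sgn_if)
    finally show ?thesis .
  qed
  have "integrable lborel (\<lambda>r. P r * f' r)"
  proof (rule Bochner_Integration.integrable_bound)
    show "integrable lborel (\<lambda>r. (x powr (a + b - 1) / Gamma (a + b)) * f' r)"
      using f'i by simp
    show "(\<lambda>r. P r * f' r) \<in> borel_measurable lborel" unfolding P_def by measurable
    show "AE r in lborel. norm (P r * f' r) \<le> norm ((x powr (a + b - 1) / Gamma (a + b)) * f' r)"
    proof (rule AE_I2)
      fix r show "norm (P r * f' r) \<le> norm ((x powr (a + b - 1) / Gamma (a + b)) * f' r)"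
      proof (cases "r \<in> {0<..x}")
        case True
        then have "(x - r) powr (a + b - 1) \<le> x powr (a + b - 1)"
          using assms by (intro powr_mono2) auto
        then show ?thesis using G by (auto simp: P_def abs_mult intro!: mult_right_mono divide_right_mono)
      qed (auto simp: f'_def)
    qed
  qed
  then have "integrable lborel (\<lambda>r. \<integral>s. norm (H r s) \<partial>lborel)"
    unfolding inner_norm by (rule integrable_norm)
  then have Hi: "integrable (lborel \<Otimes>\<^sub>M lborel) (case_prod H)"
    using inner by (intro lborel_pair.Fubini_integrable) (auto simp: has_bochner_integral_iff)
  have "RL a (RL b f) x = (\<integral>s. (\<integral>r. H r s \<partial>lborel) \<partial>lborel)"
    unfolding RL_def set_lebesgue_integral_def
  proof (rule Bochner_Integration.integral_cong[OF refl])
    fix s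
    show "indicat_real {0<..x} s *\<^sub>R ((x - s) powr (a - 1) / Gamma a *
       (LINT r|lborel. indicat_real {0<..s} r *\<^sub>R ((s - r) powr (b - 1) / Gamma b * f r))) = (LINT r|lborel. H r s)"
    proof (cases "s \<in> {0<..x}")
      case True
      have "H r s = (x - s) powr (a - 1) / Gamma a *
        (indicat_real {0<..s} r *\<^sub>R ((s - r) powr (b - 1) / Gamma b * f r))" for r
        using True by (auto simp: H_def indicator_def f'_def)
      then have "(LINT r|lborel. H r s) = (x - s) powr (a - 1) / Gamma a *
       (LINT r|lborel. indicat_real {0<..s} r *\<^sub>R ((s - r) powr (b - 1) / Gamma b * f r))"
        by (simp only: Bochner_Integration.integral_mult_right_zero)
      then show ?thesis using True by simp
    next
      case False
      then have "H r s = 0" for r by (auto simp: H_def)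
      then show ?thesis using False by simp
    qed
  qed
  also have "\<dots> = (\<integral>r. (\<integral>s. H r s \<partial>lborel) \<partial>lborel)"
    using lborel_pair.Fubini_integral[OF Hi] by simp
  also have "\<dots> = (\<integral>r. P r * f' r \<partial>lborel)"
    using inner by (intro Bochner_Integration.integral_cong) (auto simp: has_bochner_integral_iff)
  also have "\<dots> = RL (a + b) f x"
    unfolding RL_def set_lebesgue_integral_def P_def f'_def
    by (intro Bochner_Integration.integral_cong) auto
  finally show ?thesis .
qed

lemma RL_cong: "(\<And>r. 0 < r \<Longrightarrow> r \<le> x \<Longrightarrow> f r = g r) \<Longrightarrow> RL a f x = RL a g x"
  unfolding RL_def by (rule set_lebesgue_integral_cong) auto

lemma RL_scale:
  assumes "c > 0"
  shows "RL a f (c * x) = c powr a * RL a (\<lambda>r. f (c * r)) x"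
proof -
  have "RL a f (c * x) = \<bar>c\<bar> *\<^sub>R (\<integral>r. indicator {0<..c * x} (0 + c * r) *\<^sub>R ((c * x - (0 + c * r)) powr (a - 1) / Gamma a * f (0 + c * r)) \<partial>lborel)"
    unfolding RL_def set_lebesgue_integral_def using assms by (intro lborel_integral_real_affine) auto
  also have "(\<lambda>r. indicator {0<..c * x} (0 + c * r) *\<^sub>R ((c * x - (0 + c * r)) powr (a - 1) / Gamma a * f (0 + c * r)))
    = (\<lambda>r. c powr (a - 1) * (indicator {0<..x} r *\<^sub>R ((x - r) powr (a - 1) / Gamma a * f (c * r))))"
  proof
    fix r
    have "(c * x - (0 + c * r)) powr (a - 1) = c powr (a - 1) * (x - r) powr (a - 1)" if "r \<le> x"
      using that assms powr_mult[of c "x - r" "a - 1"] by (simp add: right_diff_distrib)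
    moreover have "0 + c * r \<in> {0<..c * x} \<longleftrightarrow> r \<in> {0<..x}"
      using assms by (auto simp: zero_less_mult_iff)
    ultimately show "indicator {0<..c * x} (0 + c * r) *\<^sub>R ((c * x - (0 + c * r)) powr (a - 1) / Gamma a * f (0 + c * r))
      = c powr (a - 1) * (indicator {0<..x} r *\<^sub>R ((x - r) powr (a - 1) / Gamma a * f (c * r)))"
      by (cases "r \<in> {0<..x}") auto
  qed
  also have "\<bar>c\<bar> *\<^sub>R (\<integral>r. c powr (a - 1) * (indicator {0<..x} r *\<^sub>R ((x - r) powr (a - 1) / Gamma a * f (c * r))) \<partial>lborel)
    = c powr a * RL a (\<lambda>r. f (c * r)) x"
    using assms powr_add[of c 1 "a - 1"] unfolding RL_def set_lebesgue_integral_def by simp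
  finally show ?thesis .
qed

text \<open>The kernel \<open>(x - r) powr 0\<close> is 1 on the interval except at
  \<open>r = x\<close>, where \<open>0 powr 0 = 0\<close>; the integrands differ at that single
  point.\<close>

lemma RL_1: "RL 1 f x = (LINT r:{0<..x}|lborel. f r)"
  unfolding RL_def set_lebesgue_integral_def
  by (rule integral_discrete_difference[where X = "{x}"]) (auto simp: indicator_def)

lemma singular_power_kernel:
  fixes b x :: real
  assumes "b < 1" "0 \<le> x"
  shows "set_integrable lborel {0<..x} (\<lambda>r. r powr (- b))"
    and "(LINT r:{0<..x}|lborel. r powr (- b)) = x powr (1 - b) / (1 - b)"
proof -
  show *: "set_integrable lborel {0<..x} (\<lambda>r. r powr (- b))"
  proof -
    \<comment> \<open>The right end is moved to \<open>x + 1\<close> because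
      \<open>(x + 1 - s) powr 0\<close> equals 1 on all of \<open>{0<..x}\<close>, whereas
      \<open>(x - s) powr 0\<close> is 0 at \<open>s = x\<close>.\<close>
    have "set_integrable lborel {0<..x + 1} (\<lambda>s. (x + 1 - s) powr (1 - 1) * (s - 0) powr ((1 - b) - 1))"
      using has_bochner_integral_Beta_kernel[of 1 "1 - b" 0 "x + 1"] assms
      by (simp add: set_integrable_def has_bochner_integral_iff)
    then have "set_integrable lborel {0<..x} (\<lambda>s. (x + 1 - s) powr (1 - 1) * (s - 0) powr ((1 - b) - 1))"
      by (rule set_integrable_subset) auto
    then show ?thesis
      by (rule set_integrable_cong[THEN iffD1, rotated -1]) auto
  qed
  show "(LINT r:{0<..x}|lborel. r powr (- b)) = x powr (1 - b) / (1 - b)"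
  proof (cases "x = 0")
    case False
    then have "x > 0" using assms by simp
    have "(LINT r:{0<..x}|lborel. r powr (- b)) =
      (\<integral>s. indicator {0<..x} s *\<^sub>R ((x - s) powr (1 - 1) * (s - 0) powr ((1 - b) - 1)) \<partial>lborel)"
      unfolding set_lebesgue_integral_def
    proof (rule integral_cong_AE)
      show "AE s in lborel. indicator {0<..x} s *\<^sub>R (s powr (- b)) =
        indicator {0<..x} s *\<^sub>R ((x - s) powr (1 - 1) * (s - 0) powr ((1 - b) - 1))"
        using AE_lborel_singleton[of x] by eventually_elim (auto simp: indicator_def)
    qed auto
    also have "\<dots> = x powr (1 - b) * Beta 1 (1 - b)"
      using has_bochner_integral_Beta_kernel[of 1 "1 - b" 0 x] assms \<open>x > 0\<close>
      by (simp add: has_bochner_integral_iff)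
    also have "Beta 1 (1 - b) = 1 / (1 - b)"
      using Beta_real_1[of "1 - b"] assms by (simp add: Beta_commute)
    finally show ?thesis by simp
  qed (simp add: set_lebesgue_integral_def)
qed

text \<open>\<open>f\<close> may be singular at 0, so the fundamental theorem of calculus is applied
  on \<open>{x/2..2*x}\<close> only; the integral over \<open>{0<..x/2}\<close> enters as a
  constant.\<close>

lemma has_real_derivative_set_integral:
  fixes f :: "real \<Rightarrow> real"
  assumes "continuous_on {0<..} f" "\<And>y. set_integrable lborel {0<..y} f" "0 < x"
  shows "((\<lambda>y. LINT r:{0<..y}|lborel. f r) has_real_derivative f x) (at x)"
proof -
  define C where "C = (LINT r:{0<..x/2}|lborel. f r)"
  have eq: "(LINT r:{0<..y}|lborel. f r) = C + integral {x/2..y} f" if "y \<in> {x/2<..<2*x}" for y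
  proof -
    have i: "set_integrable lborel {x/2..y} f"
      using assms that by (intro borel_integrable_atLeastAtMost') (auto intro: continuous_on_subset)
    have i2: "set_integrable lborel {x/2<..y} f" by (rule set_integrable_subset[OF i]) auto
    have "{0<..y} = {0<..x/2} \<union> {x/2<..y}" using that assms by auto
    then have "(LINT r:{0<..y}|lborel. f r) = C + (LINT r:{x/2<..y}|lborel. f r)"
      unfolding C_def using assms i2 by (simp only:) (rule set_integral_Un, auto)
    also have "(LINT r:{x/2<..y}|lborel. f r) = (LINT r:{x/2..y}|lborel. f r)"
      unfolding set_lebesgue_integral_def
      using i i2 AE_lborel_singleton[of "x/2"]
      by (intro integral_cong_AE) (auto simp: set_integrable_def indicator_def dest: borel_measurable_integrable)
    also have "\<dots> = integral {x/2..y} f" using i by (rule set_borel_integral_eq_integral)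
    finally show ?thesis .
  qed
  have "((\<lambda>y. integral {x/2..y} f) has_real_derivative f x) (at x within {x/2..2*x})"
    using assms by (intro integral_has_real_derivative) (auto intro: continuous_on_subset)
  then have "((\<lambda>y. integral {x/2..y} f) has_real_derivative f x) (at x)"
    using at_within_Icc_at[of "x/2" x "2*x"] assms(3) by simp
  then have "((\<lambda>y. C + integral {x/2..y} f) has_real_derivative f x) (at x)"
    by (auto intro!: derivative_eq_intros)
  then show ?thesis
    by (rule has_field_derivative_transform_within_open[where S = "{x/2<..<2*x}"])
      (use assms(3) eq in auto)
qed

text \<open>Comparisons of singular kernels fail at the right end, where
  \<open>(z - r) powr p\<close> with \<open>p < 0\<close> takes the value 0 instead of blowing
  up.\<close>

lemma set_integral_mono_interior:
  fixes f g :: "real \<Rightarrow> real"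
  assumes "set_integrable lborel {y<..z} f" "set_integrable lborel {y<..z} g"
    "\<And>r. y < r \<Longrightarrow> r < z \<Longrightarrow> f r \<le> g r"
  shows "(LINT r:{y<..z}|lborel. f r) \<le> (LINT r:{y<..z}|lborel. g r)"
  using AE_lborel_singleton[of z] assms
  by (intro set_integral_mono_AE) auto

lemma set_integral_abs_le:
  fixes f w :: "real \<Rightarrow> real"
  assumes "set_integrable lborel {y<..z} f" "\<And>r. y < r \<Longrightarrow> r < z \<Longrightarrow> 0 \<le> f r"
    "continuous_on {y..z} w" "\<And>r. y < r \<Longrightarrow> r < z \<Longrightarrow> \<bar>w r\<bar> \<le> B"
  shows "\<bar>LINT r:{y<..z}|lborel. f r * w r\<bar> \<le> (LINT r:{y<..z}|lborel. f r) * B"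
proof -
  have i: "set_integrable lborel {y<..z} (\<lambda>r. f r * w r)"
    using assms by (intro set_integrable_mult_continuous)
  have "f r * w r \<le> f r * B" "- (f r * w r) \<le> f r * B" if "y < r" "r < z" for r
    using mult_left_mono[of "w r" B "f r"] mult_left_mono[of "- w r" B "f r"] assms(2,4)[OF that] by auto
  moreover have "set_integrable lborel {y<..z} (\<lambda>r. f r * B)" using assms(1) by simp
  moreover have "set_integrable lborel {y<..z} (\<lambda>r. - (f r * w r))"
    using i set_integrable_mult_right[of "-1" lborel "{y<..z}" "\<lambda>r. f r * w r"] by simp
  ultimately have "(LINT r:{y<..z}|lborel. f r * w r) \<le> (LINT r:{y<..z}|lborel. f r * B)"
    "(LINT r:{y<..z}|lborel. - (f r * w r)) \<le> (LINT r:{y<..z}|lborel. f r * B)"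
    using i by (auto intro!: set_integral_mono_interior simp del: set_integral_mult_left)
  then show ?thesis using set_integral_uminus[OF i] by (simp add: abs_le_iff)
qed

lemma set_integral_Ioc_split:
  fixes f :: "real \<Rightarrow> real"
  assumes "set_integrable lborel {y<..z} f" "y \<le> a" "a \<le> z"
  shows "(LINT r:{y<..z}|lborel. f r) = (LINT r:{y<..a}|lborel. f r) + (LINT r:{a<..z}|lborel. f r)"
proof -
  have "{y<..z} = {y<..a} \<union> {a<..z}" using assms by auto
  moreover have "set_integrable lborel {y<..a} f" "set_integrable lborel {a<..z} f"
    by (rule set_integrable_subset[OF assms(1)]; use assms in auto)+
  ultimately show ?thesis by (simp only:) (rule set_integral_Un, auto)
qed

text \<open>Dominated convergence: a convergent sequence \<open>X\<close> stays in some
  \<open>{0..M}\<close>, where \<open>k\<close> is bounded. With \<open>f\<close> a Beta kernel,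
  this makes a fractional integral continuous up to 0 although its integrand is singular
  there.\<close>

lemma continuous_on_dilated_set_integral:
  fixes f k :: "real \<Rightarrow> real"
  assumes f: "set_integrable lborel {0<..1} f" and k: "continuous_on {0..} k"
  shows "continuous_on {0..} (\<lambda>x. LINT t:{0<..1}|lborel. f t * k (x * t))"
proof (subst continuous_on_sequentially, intro allI ballI impI, elim conjE)
  fix X :: "nat \<Rightarrow> real" and a assume a: "a \<in> {0..}" and X: "\<forall>n. X n \<in> {0..}" and lim: "X \<longlonglongrightarrow> a"
  obtain M where M: "\<And>n. \<bar>X n\<bar> \<le> M"
    using convergent_imp_Bseq[of X] lim by (auto simp: convergent_def Bseq_def)
  have "continuous_on {0..M} k" using k by (rule continuous_on_subset) auto
  then obtain B where B: "\<And>r. r \<in> {0..M} \<Longrightarrow> \<bar>k r\<bar> \<le> B"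
    using continuous_on_Icc_bounded by blast
  have int: "set_integrable lborel {0<..1} (\<lambda>t. f t * k (y * t))" if "y \<ge> 0" for y
    using that k by (intro set_integrable_mult_continuous f continuous_on_compose2[OF k]) (auto intro!: continuous_intros)
  have "(\<lambda>n. \<integral>t. indicator {0<..1} t *\<^sub>R (f t * k (X n * t)) \<partial>lborel)
    \<longlonglongrightarrow> (\<integral>t. indicator {0<..1} t *\<^sub>R (f t * k (a * t)) \<partial>lborel)"
  proof (rule integral_dominated_convergence[where w = "\<lambda>t. B * norm (indicator {0<..1} t *\<^sub>R f t)"])
    show "integrable lborel (\<lambda>t. B * norm (indicator {0<..1} t *\<^sub>R f t))"
      using f unfolding set_integrable_def by (intro integrable_mult_right integrable_norm)
    show "AE t in lborel. (\<lambda>n. indicator {0<..1} t *\<^sub>R (f t * k (X n * t)))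
      \<longlonglongrightarrow> indicator {0<..1} t *\<^sub>R (f t * k (a * t))"
    proof (rule AE_I2)
      fix t :: real
      have "(\<lambda>n. k (X n * t)) \<longlonglongrightarrow> k (a * t)" if "t \<in> {0<..1}"
        using that a X lim
        by (intro continuous_on_tendsto_compose[OF k] tendsto_intros) auto
      then show "(\<lambda>n. indicator {0<..1} t *\<^sub>R (f t * k (X n * t)))
        \<longlonglongrightarrow> indicator {0<..1} t *\<^sub>R (f t * k (a * t))"
        by (cases "t \<in> {0<..1}") (auto intro!: tendsto_intros)
    qed
    show "AE t in lborel. norm (indicator {0<..1} t *\<^sub>R (f t * k (X n * t))) \<le> B * norm (indicator {0<..1} t *\<^sub>R f t)" for n
    proof (rule AE_I2)
      fix t :: real
      have "\<bar>k (X n * t)\<bar> \<le> B" if "t \<in> {0<..1}"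
      proof (rule B)
        have "X n * t \<le> \<bar>X n\<bar> * 1" using that by (intro mult_mono) auto
        then show "X n * t \<in> {0..M}" using X M[of n] that by auto
      qed
      then show "norm (indicator {0<..1} t *\<^sub>R (f t * k (X n * t))) \<le> B * norm (indicator {0<..1} t *\<^sub>R f t)"
        using mult_left_mono[of "\<bar>k (X n * t)\<bar>" B "\<bar>f t\<bar>"]
        by (cases "t \<in> {0<..1}") (auto simp: abs_mult mult.commute)
    qed
  qed (use int a X f in \<open>auto simp: set_integrable_def dest!: borel_measurable_integrable\<close>)
  then show "((\<lambda>x. LINT t:{0<..1}|lborel. f t * k (x * t)) \<circ> X) \<longlonglongrightarrow> (LINT t:{0<..1}|lborel. f t * k (a * t))"
    by (simp add: set_lebesgue_integral_def o_def)
qed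

text \<open>Substituting \<open>r = x * t\<close>, the factor \<open>x powr \<beta>\<close> from
  scaling cancels \<open>x powr (- \<beta>)\<close> from the weight, which leaves a fixed
  domain.\<close>

lemma RL_singular_rescale:
  assumes "0 < x"
  shows "RL \<beta> (\<lambda>r. r powr (- \<beta>) * k r) x =
    (LINT t:{0<..1}|lborel. ((1 - t) powr (\<beta> - 1) * t powr (- \<beta>)) / Gamma \<beta> * k (x * t))"
proof -
  have "RL \<beta> (\<lambda>r. r powr (- \<beta>) * k r) (x * 1) =
    x powr \<beta> * RL \<beta> (\<lambda>t. (x * t) powr (- \<beta>) * k (x * t)) 1"
    by (rule RL_scale[OF assms])
  also have "RL \<beta> (\<lambda>t. (x * t) powr (- \<beta>) * k (x * t)) 1 =
    (LINT t:{0<..1}|lborel. x powr (- \<beta>) * (((1 - t) powr (\<beta> - 1) * t powr (- \<beta>)) / Gamma \<beta> * k (x * t)))"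
    unfolding RL_def by (intro set_lebesgue_integral_cong) (use assms in \<open>auto simp: powr_mult\<close>)
  finally show ?thesis using assms powr_add[of x \<beta> "- \<beta>"] by simp
qed

section \<open>Inversion of the fractional integral of order 1 - \<beta>\<close>

lemma abs_le_powr_imp_const_0:
  fixes D p K :: real
  assumes "p > 0" "\<And>y. 0 < y \<Longrightarrow> y \<le> 1 \<Longrightarrow> \<bar>D\<bar> \<le> K * y powr p"
  shows "D = 0"
proof -
  have "((\<lambda>y. K * y powr p) \<longlongrightarrow> K * 0) (at_right 0)"
    using assms(1) by (intro tendsto_intros tendsto_zero_powrI[where b = p])
      (auto simp: eventually_at_right_less eventually_at_filter)
  moreover have "\<forall>\<^sub>F y in at_right 0. \<bar>D\<bar> \<le> K * y powr p"
    using assms(2) by (auto simp: eventually_at_right_field intro!: exI[of _ 1])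
  ultimately have "\<bar>D\<bar> \<le> K * 0"
    by (intro tendsto_lowerbound[where F = "at_right 0"]) auto
  then show ?thesis by simp
qed

text \<open>Writing \<open>J\<^sup>a\<close> for \<open>RL a\<close> and \<open>g x = x powr (- \<beta>) * k x\<close>: \<open>J\<^sup>1 w = J\<^sup>\<beta> (J\<^bsup>1-\<beta>\<^esup> w) = J\<^sup>\<beta> (J\<^sup>1 g) = J\<^sup>1 (J\<^sup>\<beta> g)\<close>;
  now differentiate.\<close>
lemma RL_inversion:
  assumes \<beta>: "0 < \<beta>" "\<beta> < 1" and w: "continuous_on {0..} w" and k: "continuous_on {0..} k"
    and D: "\<And>x. 0 < x \<Longrightarrow> (RL (1 - \<beta>) w has_real_derivative x powr (- \<beta>) * k x) (at x)"
    and "0 < x"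
  shows "w x = RL \<beta> (\<lambda>r. r powr (- \<beta>) * k r) x"
proof -
  define g where "g = (\<lambda>r. r powr (- \<beta>) * k r)"
  define Q where "Q = (\<lambda>x. LINT t:{0<..1}|lborel. ((1 - t) powr (\<beta> - 1) * t powr (- \<beta>)) / Gamma \<beta> * k (x * t))"
  have G: "Gamma \<beta> > 0" "Gamma (1 - \<beta>) > 0" using \<beta> by (auto intro: Gamma_real_pos)
  have ksub: "continuous_on {0..y} k" and wsub: "continuous_on {0..y} w" for y
    using w k by (auto intro: continuous_on_subset)
  have gi: "set_integrable lborel {0<..y} g" for y
  proof (cases "0 \<le> y")
    case True
    then show ?thesis unfolding g_def
      using \<beta> singular_power_kernel(1)[of \<beta> y] ksub by (intro set_integrable_mult_continuous) auto
  next
    case False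
    then have "{0<..y} = {}" by auto
    then show ?thesis by (simp only: set_integrable_empty)
  qed
  have gc: "continuous_on {0<..} g"
    unfolding g_def by (intro continuous_intros continuous_on_subset[OF k]) auto
  have wi: "set_integrable lborel {0<..y} w" for y
  proof -
    have "set_integrable lborel {0..y} w" using wsub by (rule borel_integrable_atLeastAtMost')
    then show ?thesis by (rule set_integrable_subset) auto
  qed
  have Qc: "continuous_on {0..} Q"
    unfolding Q_def
    using has_bochner_integral_Beta_kernel[of \<beta> "1 - \<beta>" 0 1] \<beta> k
    by (intro continuous_on_dilated_set_integral set_integrable_divide)
      (auto simp: set_integrable_def has_bochner_integral_iff)
  have Qi: "set_integrable lborel {0<..y} Q" for y
  proof -
    have "set_integrable lborel {0..y} Q" 
      by (rule borel_integrable_atLeastAtMost') (auto intro: continuous_on_subset[OF Qc])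
    then show ?thesis by (rule set_integrable_subset) auto
  qed
  have Qeq: "RL \<beta> g y = Q y" if "0 < y" for y
    unfolding g_def Q_def by (rule RL_singular_rescale[OF that])
  have RL1g: "RL (1 - \<beta>) w y = RL 1 g y" if "0 < y" for y
  proof -
    \<comment> \<open>Equal derivatives leave an unknown constant \<open>F\<close>; it is zero
      because both integrals are bounded by multiples of \<open>z powr (1 - \<beta>)\<close> near
      0.\<close>
    define F where "F = (\<lambda>y. RL (1 - \<beta>) w y - RL 1 g y)"
    have "(F has_real_derivative 0) (at y)" if "0 < y" for y
      using DERIV_diff[OF D[OF that] has_real_derivative_set_integral[OF gc gi that]]
      unfolding F_def RL_1 g_def by simp
    then have const: "F z = F y" if "0 < z" for z
      using that \<open>0 < y\<close>
      by (intro DERIV_isconst3[of 0 "y + z + 1" z y F]) auto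
    obtain B where B: "\<And>r. r \<in> {0..1} \<Longrightarrow> \<bar>w r\<bar> \<le> B" "\<And>r. r \<in> {0..1} \<Longrightarrow> \<bar>k r\<bar> \<le> B"
    proof -
      obtain B1 B2 where "\<And>r. r \<in> {0..1} \<Longrightarrow> \<bar>w r\<bar> \<le> B1" "\<And>r. r \<in> {0..1} \<Longrightarrow> \<bar>k r\<bar> \<le> B2"
        using continuous_on_Icc_bounded[OF wsub] continuous_on_Icc_bounded[OF ksub] by metis
      then have "\<bar>w r\<bar> \<le> max B1 B2" "\<bar>k r\<bar> \<le> max B1 B2" if "r \<in> {0..1}" for r
        using that by (auto simp: le_max_iff_disj)
      then show thesis using that by blast
    qed
    have "F y = 0"
    proof (rule abs_le_powr_imp_const_0)
      show "0 < 1 - \<beta>" using \<beta> by simp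
      fix z :: real assume z: "0 < z" "z \<le> 1"
      have "\<bar>LINT r:{0<..z}|lborel. (z - r) powr (1 - \<beta> - 1) * w r\<bar> \<le> (LINT r:{0<..z}|lborel. (z - r) powr (1 - \<beta> - 1)) * B"
        using z \<beta> B(1) wsub power_kernel(1)[of "1 - \<beta>" 0 z] by (intro set_integral_abs_le) auto
      also have "\<dots> = z powr (1 - \<beta>) / (1 - \<beta>) * B"
        using z \<beta> power_kernel(2)[of "1 - \<beta>" 0 z] by simp
      finally have "\<bar>LINT r:{0<..z}|lborel. (z - r) powr (1 - \<beta> - 1) * w r\<bar> / Gamma (1 - \<beta>)
        \<le> z powr (1 - \<beta>) / (1 - \<beta>) * B / Gamma (1 - \<beta>)"
        using G by (intro divide_right_mono) auto
      then have 1: "\<bar>RL (1 - \<beta>) w z\<bar> \<le> z powr (1 - \<beta>) / (1 - \<beta>) * B / Gamma (1 - \<beta>)"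
        using G by (simp add: RL_def abs_divide)
      have "\<bar>RL 1 g z\<bar> \<le> (LINT r:{0<..z}|lborel. r powr (- \<beta>)) * B"
        unfolding RL_1 g_def
        using z \<beta> B(2) ksub singular_power_kernel(1)[of \<beta> z] by (intro set_integral_abs_le) auto
      also have "\<dots> = z powr (1 - \<beta>) / (1 - \<beta>) * B"
        using z \<beta> singular_power_kernel(2)[of \<beta> z] by simp
      finally have 2: "\<bar>RL 1 g z\<bar> \<le> z powr (1 - \<beta>) / (1 - \<beta>) * B" .
      have "\<bar>F z\<bar> \<le> z powr (1 - \<beta>) / (1 - \<beta>) * B / Gamma (1 - \<beta>) + z powr (1 - \<beta>) / (1 - \<beta>) * B"
        unfolding F_def using 1 2 by linarith
      then show "\<bar>F y\<bar> \<le> (B / (1 - \<beta>) / Gamma (1 - \<beta>) + B / (1 - \<beta>)) * z powr (1 - \<beta>)"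
        using const[OF z(1)] by (simp add: algebra_simps)
    qed
    then show ?thesis by (simp add: F_def)
  qed
  have RL1: "RL 1 w y = RL 1 Q y" if "0 < y" for y
  proof -
    have "RL 1 w y = RL \<beta> (RL (1 - \<beta>) w) y"
      using RL_semigroup[of \<beta> "1 - \<beta>" y w] \<beta> wi by simp
    also have "\<dots> = RL \<beta> (RL 1 g) y" by (rule RL_cong) (rule RL1g)
    also have "\<dots> = RL 1 (RL \<beta> g) y"
      using RL_semigroup[of \<beta> 1 y g] RL_semigroup[of 1 \<beta> y g] \<beta> gi by (simp add: add.commute)
    also have "\<dots> = RL 1 Q y" by (rule RL_cong) (rule Qeq)
    finally show ?thesis .
  qed
  have RL1': "RL 1 f = (\<lambda>y. LINT r:{0<..y}|lborel. f r)" for f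
    by (simp add: fun_eq_iff RL_1)
  have "(RL 1 w has_real_derivative w x) (at x)"
    unfolding RL1' by (rule has_real_derivative_set_integral[OF _ wi \<open>0 < x\<close>]) (auto intro: continuous_on_subset[OF w])
  moreover have "(RL 1 Q has_real_derivative Q x) (at x)"
    unfolding RL1' by (rule has_real_derivative_set_integral[OF _ Qi \<open>0 < x\<close>]) (auto intro: continuous_on_subset[OF Qc])
  then have "(RL 1 w has_real_derivative Q x) (at x)"
    by (rule has_field_derivative_transform_within_open[where S = "{0<..}"]) (use RL1 \<open>0 < x\<close> in auto)
  ultimately have "w x = Q x" by (rule DERIV_unique)
  then show ?thesis using Qeq[OF \<open>0 < x\<close>] by (simp add: g_def)
qed

section \<open>The comparison principle\<close>

text \<open>Mean value theorem; for \<open>p \<le> 1\<close> the factor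
  \<open>s powr (p - 1)\<close> is largest at the left end. It is used for the kernel exponent
  \<open>\<beta> - 1\<close> and for \<open>\<beta>\<close> itself.\<close>

lemma powr_diff_le:
  fixes p c y z :: real
  assumes "0 < c" "c \<le> y" "y \<le> z" "p \<le> 1"
  shows "\<bar>z powr p - y powr p\<bar> \<le> \<bar>p\<bar> * c powr (p - 1) * (z - y)"
proof (cases "y = z")
  case False
  then have "y < z" using assms by simp
  moreover have "DERIV (\<lambda>s. s powr p) s :> p * s powr (p - 1)" if "y \<le> s" for s
    using that assms by (auto intro!: derivative_eq_intros)
  ultimately obtain \<xi> where \<xi>: "y < \<xi>" "\<xi> < z" "z powr p - y powr p = (z - y) * (p * \<xi> powr (p - 1))"
    using MVT2[of y z "\<lambda>s. s powr p" "\<lambda>s. p * s powr (p - 1)"] by auto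
  have "\<xi> powr (p - 1) \<le> c powr (p - 1)"
    using assms \<xi> by (intro powr_mono2') auto
  then have "(z - y) * (\<bar>p\<bar> * \<xi> powr (p - 1)) \<le> (z - y) * (\<bar>p\<bar> * c powr (p - 1))"
    using assms by (intro mult_left_mono) auto
  then show ?thesis using \<xi>(3) assms by (simp add: abs_mult mult.commute mult.left_commute)
qed simp

text \<open>The bound \<open>o ((x0 - x) powr \<beta>)\<close>, instead of the generic \<open>O\<close>, comes from subtracting the
  constant \<open>g x0\<close>, whose fractional integral is smooth away from the origin.\<close>
lemma RL_increment_small:
  assumes \<beta>: "0 < \<beta>" "\<beta> < 1" and x0: "0 < x0" and \<epsilon>: "0 < \<epsilon>"
    and gi: "set_integrable lborel {0<..x0} g" and gc: "continuous_on {0<..} g"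
    and ki: "\<And>x. 0 < x \<Longrightarrow> set_integrable lborel {0<..x} (\<lambda>r. (x - r) powr (\<beta> - 1) * g r)"
  shows "\<exists>\<delta>>0. \<forall>x. x0 - \<delta> < x \<and> x < x0 \<longrightarrow> RL \<beta> g x - RL \<beta> g x0 \<le> \<epsilon> * (x0 - x) powr \<beta>"
proof -
  define G where "G = Gamma \<beta>"
  have G: "G > 0" unfolding G_def using \<beta> by (auto intro: Gamma_real_pos)
  \<comment> \<open>Two terms of size \<open>\<eta> / \<beta> * h powr \<beta>\<close>, divided by
    \<open>G\<close>, use up half of \<open>\<epsilon>\<close>; the other half absorbs the terms
    linear in \<open>h\<close>.\<close>
  define \<eta> where "\<eta> = \<epsilon> * \<beta> * G / 4"
  have \<eta>: "\<eta> > 0" using \<beta> \<epsilon> G by (simp add: \<eta>_def)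
  define m where "m = g x0"
  have "isCont g x0" using gc x0 by (simp add: continuous_on_eq_continuous_at)
  then obtain d where d: "d > 0" "\<And>r. \<bar>r - x0\<bar> < d \<Longrightarrow> \<bar>g r - m\<bar> < \<eta>"
    unfolding continuous_at_eps_delta m_def using \<eta> by (auto simp: dist_real_def)
  define a where "a = max (x0 / 2) (x0 - d / 2)"
  have a: "0 < a" "a < x0" using x0 d(1) by (auto simp: a_def)
  have q_small: "\<bar>g r - m\<bar> \<le> \<eta>" if "a \<le> r" "r \<le> x0" for r
    using d(2)[of r] that d(1) by (auto simp: a_def intro!: less_imp_le)
  \<comment> \<open>For \<open>x \<ge> b\<close> and \<open>r \<le> a\<close> the distance
    \<open>x - r\<close> is at least \<open>b - a\<close>, so away from \<open>x0\<close> the kernel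
    is Lipschitz in \<open>x\<close>.\<close>
  define b where "b = (a + x0) / 2"
  have b: "a < b" "b < x0" using a by (auto simp: b_def)
  define q where "q = (\<lambda>r. g r - m)"
  define p where "p = \<beta> - 1"
  have mi: "set_integrable lborel {0<..x} (\<lambda>r. (x - r) powr p)" if "0 < x" for x
    unfolding p_def using power_kernel(1)[of \<beta> 0 x] \<beta> that by simp
  have qi: "set_integrable lborel {0<..x} (\<lambda>r. (x - r) powr p * q r)" if "0 < x" for x
    using set_integral_diff(1)[OF ki[OF that], of "\<lambda>r. (x - r) powr p * m"] mi[OF that]
    by (simp add: q_def right_diff_distrib p_def)
  define A where "A = (\<lambda>x. LINT r:{0<..x}|lborel. (x - r) powr p * q r)"
  have RLeq: "G * RL \<beta> g x = A x + m * x powr \<beta> / \<beta>" if "0 < x" for x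
  proof -
    have "G * RL \<beta> g x = (LINT r:{0<..x}|lborel. (x - r) powr p * g r)"
      unfolding RL_def G_def[symmetric] p_def[symmetric] using G
      by (subst set_integral_mult_right[symmetric]) simp
    also have "\<dots> = (LINT r:{0<..x}|lborel. (x - r) powr p * q r + (x - r) powr p * m)"
      by (simp add: q_def algebra_simps)
    also have "\<dots> = A x + (LINT r:{0<..x}|lborel. (x - r) powr p * m)"
      unfolding A_def by (rule set_integral_add(2)) (use qi[OF that] mi[OF that] in auto)
    also have "(LINT r:{0<..x}|lborel. (x - r) powr p * m) = x powr \<beta> / \<beta> * m"
      using power_kernel(2)[of \<beta> 0 x] that \<beta> by (simp add: p_def)
    finally show ?thesis by simp
  qed
  have q1i: "set_integrable lborel {0<..a} q"
  proof -
    have "set_integrable lborel {0<..a} g" by (rule set_integrable_subset[OF gi]) (use a in auto)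
    moreover have "set_integrable lborel {0<..a} (\<lambda>r. m)"
      by (rule set_integrable_subset[of _ "{0..a}"]) (auto intro!: borel_integrable_atLeastAtMost')
    ultimately show ?thesis unfolding q_def by (rule set_integral_diff(1))
  qed
  define K where "K = (LINT r:{0<..a}|lborel. \<bar>q r\<bar>)"
  define C1 where "C1 = \<bar>p\<bar> * (b - a) powr (p - 1) * K"
  define C2 where "C2 = \<bar>m\<bar> * b powr (\<beta> - 1)"
  define C where "C = \<bar>C1\<bar> + C2 + 1"
  have C: "C > 0" by (auto simp: C_def C2_def intro!: add_nonneg_pos)
  have main: "G * (RL \<beta> g x - RL \<beta> g x0) \<le> C * (x0 - x) + 2 * \<eta> / \<beta> * (x0 - x) powr \<beta>"
    if x: "b \<le> x" "x < x0" for x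
  proof -
    define h where "h = x0 - x"
    have h: "h > 0" and x_pos: "0 < x" "a < x" using x a b by (auto simp: h_def)
    note i1 = qi[OF x_pos(1)] and i2 = qi[OF x0]
    have i2x: "set_integrable lborel {0<..x} (\<lambda>r. (x0 - r) powr p * q r)"
      by (rule set_integrable_subset[OF i2]) (use x in auto)
    define D where "D = (\<lambda>r. (x - r) powr p - (x0 - r) powr p)"
    have Di: "set_integrable lborel {0<..x} (\<lambda>r. D r * q r)"
      using set_integral_diff(1)[OF i1 i2x] by (simp add: D_def left_diff_distrib)
    have "A x0 = (LINT r:{0<..x}|lborel. (x0 - r) powr p * q r) + (LINT r:{x<..x0}|lborel. (x0 - r) powr p * q r)"
      unfolding A_def by (rule set_integral_Ioc_split[OF i2]) (use x x_pos in auto)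
    moreover have "A x - (LINT r:{0<..x}|lborel. (x0 - r) powr p * q r) = (LINT r:{0<..x}|lborel. D r * q r)"
      unfolding A_def D_def left_diff_distrib by (rule set_integral_diff(2)[OF i1 i2x, symmetric])
    moreover have "(LINT r:{0<..x}|lborel. D r * q r) = (LINT r:{0<..a}|lborel. D r * q r) + (LINT r:{a<..x}|lborel. D r * q r)"
      by (rule set_integral_Ioc_split[OF Di]) (use a x_pos in auto)
    ultimately have Adiff: "A x - A x0 = (LINT r:{0<..a}|lborel. D r * q r) + (LINT r:{a<..x}|lborel. D r * q r)
      - (LINT r:{x<..x0}|lborel. (x0 - r) powr p * q r)" by linarith
    have T1: "(LINT r:{0<..a}|lborel. D r * q r) \<le> \<bar>C1\<bar> * h"
    proof -
      have "(LINT r:{0<..a}|lborel. D r * q r) \<le> (LINT r:{0<..a}|lborel. (\<bar>p\<bar> * (b - a) powr (p - 1) * h) * \<bar>q r\<bar>)"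
      proof (rule set_integral_mono)
        show "set_integrable lborel {0<..a} (\<lambda>r. D r * q r)"
          by (rule set_integrable_subset[OF Di]) (use x_pos in auto)
        show "set_integrable lborel {0<..a} (\<lambda>r. (\<bar>p\<bar> * (b - a) powr (p - 1) * h) * \<bar>q r\<bar>)"
          using set_integrable_abs[OF q1i] by simp
        fix r assume "r \<in> {0<..a}"
        then have "\<bar>(x0 - r) powr p - (x - r) powr p\<bar> \<le> \<bar>p\<bar> * (b - a) powr (p - 1) * ((x0 - r) - (x - r))"
          using x b \<beta> by (intro powr_diff_le) (auto simp: p_def)
        then have "\<bar>D r\<bar> \<le> \<bar>p\<bar> * (b - a) powr (p - 1) * h"
          by (simp add: D_def h_def abs_minus_commute)
        then have "\<bar>D r * q r\<bar> \<le> (\<bar>p\<bar> * (b - a) powr (p - 1) * h) * \<bar>q r\<bar>"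
          unfolding abs_mult by (rule mult_right_mono) auto
        then show "D r * q r \<le> (\<bar>p\<bar> * (b - a) powr (p - 1) * h) * \<bar>q r\<bar>" by linarith
      qed
      also have "\<dots> = C1 * h" by (simp add: C1_def K_def)
      also have "\<dots> \<le> \<bar>C1\<bar> * h" using h by (intro mult_right_mono) auto
      finally show ?thesis .
    qed
    have qc: "continuous_on {a..x0} q"
      unfolding q_def using a by (intro continuous_intros continuous_on_subset[OF gc]) auto
    have ik1: "set_integrable lborel {a<..x} (\<lambda>r. (x - r) powr p)"
      unfolding p_def using power_kernel(1)[of \<beta> a x] \<beta> x_pos by simp
    have ik2: "set_integrable lborel {a<..x0} (\<lambda>r. (x0 - r) powr p)"
      unfolding p_def using power_kernel(1)[of \<beta> a x0] \<beta> a by simp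
    have ik3: "set_integrable lborel {a<..x} (\<lambda>r. (x0 - r) powr p)"
      by (rule set_integrable_subset[OF ik2]) (use x in auto)
    have k3: "(LINT r:{x<..x0}|lborel. (x0 - r) powr p) = h powr \<beta> / \<beta>"
      using power_kernel(2)[of \<beta> x x0] \<beta> x by (simp add: p_def h_def)
    \<comment> \<open>\<open>D\<close> is nonnegative and both kernels integrate explicitly, so its
      mass on \<open>{a<..x}\<close> is at most \<open>h powr \<beta> / \<beta>\<close>; the
      smallness of \<open>q\<close> near \<open>x0\<close> supplies the factor
      \<open>\<eta>\<close>.\<close>
    have T2: "(LINT r:{a<..x}|lborel. D r * q r) \<le> \<eta> / \<beta> * h powr \<beta>"
    proof -
      have "\<bar>LINT r:{a<..x}|lborel. D r * q r\<bar> \<le> (LINT r:{a<..x}|lborel. D r) * \<eta>"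
      proof (rule set_integral_abs_le)
        show "set_integrable lborel {a<..x} D"
          unfolding D_def using ik1 ik3 by (rule set_integral_diff(1))
        show "0 \<le> D r" if "a < r" "r < x" for r
          unfolding D_def using that x \<beta> by (simp add: p_def powr_mono2')
        show "continuous_on {a..x} q" by (rule continuous_on_subset[OF qc]) (use x in auto)
        show "\<bar>q r\<bar> \<le> \<eta>" if "a < r" "r < x" for r
          using q_small[of r] that x by (simp add: q_def)
      qed
      also have "(LINT r:{a<..x}|lborel. D r) = (x - a) powr \<beta> / \<beta> - (LINT r:{a<..x}|lborel. (x0 - r) powr p)"
        unfolding D_def using set_integral_diff(2)[OF ik1 ik3] power_kernel(2)[of \<beta> a x] \<beta> x_pos
        by (simp add: p_def)
      also have "(LINT r:{a<..x}|lborel. (x0 - r) powr p) = (x0 - a) powr \<beta> / \<beta> - h powr \<beta> / \<beta>"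
        using set_integral_Ioc_split[OF ik2, of x] k3 power_kernel(2)[of \<beta> a x0] \<beta> a x x_pos
        by (simp add: p_def)
      also have "((x - a) powr \<beta> / \<beta> - ((x0 - a) powr \<beta> / \<beta> - h powr \<beta> / \<beta>)) * \<eta> \<le> h powr \<beta> / \<beta> * \<eta>"
      proof (rule mult_right_mono)
        have "(x - a) powr \<beta> / \<beta> \<le> (x0 - a) powr \<beta> / \<beta>"
          using x x_pos \<beta> by (intro divide_right_mono powr_mono2) auto
        then show "(x - a) powr \<beta> / \<beta> - ((x0 - a) powr \<beta> / \<beta> - h powr \<beta> / \<beta>) \<le> h powr \<beta> / \<beta>" by linarith
      qed (use \<eta> in simp)
      finally show ?thesis by (simp add: mult.commute)
    qed
    have T3: "\<bar>LINT r:{x<..x0}|lborel. (x0 - r) powr p * q r\<bar> \<le> \<eta> / \<beta> * h powr \<beta>"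
    proof -
      have "\<bar>LINT r:{x<..x0}|lborel. (x0 - r) powr p * q r\<bar> \<le> (LINT r:{x<..x0}|lborel. (x0 - r) powr p) * \<eta>"
      proof (rule set_integral_abs_le)
        show "set_integrable lborel {x<..x0} (\<lambda>r. (x0 - r) powr p)"
          by (rule set_integrable_subset[OF ik2]) (use x_pos in auto)
        show "continuous_on {x..x0} q" by (rule continuous_on_subset[OF qc]) (use x_pos in auto)
        show "\<bar>q r\<bar> \<le> \<eta>" if "x < r" "r < x0" for r
          using q_small[of r] that x_pos by (simp add: q_def)
      qed auto
      then show ?thesis unfolding k3 by (simp add: mult.commute)
    qed
    have T4: "m * x powr \<beta> / \<beta> - m * x0 powr \<beta> / \<beta> \<le> C2 * h"
    proof -
      have "\<bar>x0 powr \<beta> - x powr \<beta>\<bar> \<le> \<bar>\<beta>\<bar> * b powr (\<beta> - 1) * (x0 - x)"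
        using x a b \<beta> by (intro powr_diff_le) auto
      then have "\<bar>m\<bar> * \<bar>x0 powr \<beta> - x powr \<beta>\<bar> \<le> \<bar>m\<bar> * (\<beta> * b powr (\<beta> - 1) * h)"
        using \<beta> by (intro mult_left_mono) (auto simp: h_def)
      moreover have "m * x powr \<beta> - m * x0 powr \<beta> \<le> \<bar>m\<bar> * \<bar>x0 powr \<beta> - x powr \<beta>\<bar>"
        unfolding abs_mult[symmetric] right_diff_distrib by linarith
      ultimately have "m * x powr \<beta> - m * x0 powr \<beta> \<le> \<beta> * (C2 * h)"
        by (simp add: C2_def algebra_simps)
      then have "(m * x powr \<beta> - m * x0 powr \<beta>) / \<beta> \<le> C2 * h"
        using \<beta> by (simp add: divide_le_eq mult.commute)
      then show ?thesis by (simp add: diff_divide_distrib)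
    qed
    have "G * (RL \<beta> g x - RL \<beta> g x0) = A x - A x0 + (m * x powr \<beta> / \<beta> - m * x0 powr \<beta> / \<beta>)"
      using RLeq[OF x_pos(1)] RLeq[OF x0] by (simp add: right_diff_distrib)
    also have "\<dots> \<le> \<bar>C1\<bar> * h + C2 * h + 2 * (\<eta> / \<beta> * h powr \<beta>)"
      using Adiff T1 T2 T3 T4 by linarith
    also have "\<dots> \<le> C * h + 2 * (\<eta> / \<beta> * h powr \<beta>)"
      using h by (simp add: C_def algebra_simps)
    finally show ?thesis by (simp add: h_def)
  qed
  \<comment> \<open>The second entry solves
    \<open>C * h powr (1 - \<beta>) = \<epsilon> * G / 2\<close> for \<open>h\<close>; below it the
    linear term fits into its half of \<open>\<epsilon>\<close>.\<close>
  define \<delta> where "\<delta> = min (x0 - b) ((\<epsilon> * G / (2 * C)) powr (1 / (1 - \<beta>)))"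
  have "\<delta> > 0" using b \<epsilon> G C by (simp add: \<delta>_def)
  moreover have "RL \<beta> g x - RL \<beta> g x0 \<le> \<epsilon> * (x0 - x) powr \<beta>" if x: "x0 - \<delta> < x" "x < x0" for x
  proof -
    define h where "h = x0 - x"
    have h: "0 < h" "h \<le> (\<epsilon> * G / (2 * C)) powr (1 / (1 - \<beta>))" and bx: "b \<le> x"
      using x by (auto simp: h_def \<delta>_def)
    have "h powr (1 - \<beta>) \<le> ((\<epsilon> * G / (2 * C)) powr (1 / (1 - \<beta>))) powr (1 - \<beta>)"
      using h \<beta> by (intro powr_mono2) auto
    also have "\<dots> = \<epsilon> * G / (2 * C)" using \<epsilon> G C \<beta> by (simp add: powr_powr)
    finally have "C * h powr (1 - \<beta>) \<le> \<epsilon> * G / 2" using C by (simp add: field_simps)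
    then have "C * h powr (1 - \<beta>) * h powr \<beta> \<le> \<epsilon> * G / 2 * h powr \<beta>"
      by (rule mult_right_mono) auto
    moreover have "h powr (1 - \<beta>) * h powr \<beta> = h"
      using h by (simp add: powr_add[symmetric])
    ultimately have "C * h \<le> \<epsilon> * G / 2 * h powr \<beta>" by (simp add: mult.assoc)
    moreover have "2 * \<eta> / \<beta> * h powr \<beta> = \<epsilon> * G / 2 * h powr \<beta>"
      using \<beta> by (simp add: \<eta>_def)
    ultimately have "G * (RL \<beta> g x - RL \<beta> g x0) \<le> \<epsilon> * G / 2 * h powr \<beta> + \<epsilon> * G / 2 * h powr \<beta>"
      using main[OF bx x(2), folded h_def] by linarith
    also have "\<dots> = G * (\<epsilon> * h powr \<beta>)" by (simp add: field_simps)
    finally show ?thesis unfolding h_def mult_le_cancel_left_pos[OF G] .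
  qed
  ultimately show ?thesis by blast
qed

text \<open>\<open>neg\<close> says that the censored derivative of \<open>w\<close> is positive
  wherever \<open>w\<close> is negative. At a negative minimum \<open>x0\<close> over
  \<open>{0..y}\<close> this is impossible: the backward difference of the fractional integral of
  \<open>w - w x0\<close> is too small.\<close>

theorem RL_comparison:
  assumes \<beta>: "0 < \<beta>" "\<beta> < 1" and w: "continuous_on {0..} w" and k: "continuous_on {0..} k"
    and D: "\<And>x. 0 < x \<Longrightarrow> (RL (1 - \<beta>) w has_real_derivative x powr (- \<beta>) * k x) (at x)"
    and w0: "0 \<le> w 0" and neg: "\<And>x. 0 < x \<Longrightarrow> w x < 0 \<Longrightarrow> w x / Gamma (1 - \<beta>) < k x"
    and "0 \<le> y"
  shows "0 \<le> w y"
proof (rule ccontr)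
  assume wy: "\<not> 0 \<le> w y"
  define G where "G = Gamma (1 - \<beta>)"
  have G: "G > 0" unfolding G_def using \<beta> by (auto intro: Gamma_real_pos)
  have wsub: "continuous_on {0..z} w" for z using w by (auto intro: continuous_on_subset)
  obtain x0 where x0: "x0 \<in> {0..y}" and min: "\<And>z. z \<in> {0..y} \<Longrightarrow> w x0 \<le> w z"
    using continuous_attains_inf[of "{0..y}" w] wsub \<open>0 \<le> y\<close> by auto
  have wx0: "w x0 < 0" using min[of y] wy \<open>0 \<le> y\<close> by auto
  have x0_pos: "0 < x0" using x0 wx0 w0 by (cases "x0 = 0") auto
  define g where "g = (\<lambda>r. r powr (- \<beta>) * k r)"
  have ksub: "continuous_on {0..z} k" for z using k by (auto intro: continuous_on_subset)
  have inv: "w x = RL \<beta> g x" if "0 < x" for x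
    unfolding g_def using RL_inversion[OF \<beta> w k D that] .
  define v where "v = (\<lambda>r. w r - w x0)"
  have v_nonneg: "0 \<le> v r" if "0 \<le> r" "r \<le> x0" for r
    using min[of r] that x0 by (auto simp: v_def)
  \<comment> \<open>\<open>F\<close> is the fractional integral of \<open>v\<close>. Constants have
    zero censored derivative, so the derivative of \<open>F\<close> at \<open>x0\<close> is the
    censored derivative of \<open>w\<close> there.\<close>
  define F where "F = (\<lambda>x. RL (1 - \<beta>) w x - w x0 * (x powr (1 - \<beta>) / (1 - \<beta>)) / G)"
  have "(F has_real_derivative x0 powr (- \<beta>) * k x0 - w x0 * x0 powr (- \<beta>) / G) (at x0)"
    unfolding F_def using x0_pos \<beta> G
    by (auto intro!: derivative_eq_intros D)
  moreover have "x0 powr (- \<beta>) * k x0 - w x0 * x0 powr (- \<beta>) / G = x0 powr (- \<beta>) * (k x0 - w x0 / G)"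
    by (simp add: field_simps)
  ultimately have F': "(F has_real_derivative x0 powr (- \<beta>) * (k x0 - w x0 / G)) (at x0)" by simp
  define \<rho> where "\<rho> = x0 powr (- \<beta>) * (k x0 - w x0 / G)"
  have \<rho>: "\<rho> > 0" using neg[OF x0_pos wx0] x0_pos by (simp add: \<rho>_def G_def)
  \<comment> \<open>Subtracting the slope \<open>\<rho> / 2\<close> makes the sign of the derivative
    quantitative: \<open>F x0 - F (x0 - h) > \<rho> / 2 * h\<close>.\<close>
  have "((\<lambda>x. F x - \<rho> / 2 * x) has_real_derivative \<rho> / 2) (at x0)"
    using F' by (auto intro!: derivative_eq_intros simp: \<rho>_def[symmetric])
  then obtain d1 where d1: "d1 > 0" "\<And>h. 0 < h \<Longrightarrow> h < d1 \<Longrightarrow> F (x0 - h) - \<rho> / 2 * (x0 - h) < F x0 - \<rho> / 2 * x0"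
    using DERIV_pos_inc_left[of "\<lambda>x. F x - \<rho> / 2 * x" "\<rho> / 2" x0] \<rho> by auto
  \<comment> \<open>With this value the bound \<open>h * \<epsilon>\<close> on
    \<open>G * (F x0 - F x)\<close> becomes \<open>F x0 - F x \<le> \<rho> / 2 * h\<close>, the
    contradiction.\<close>
  define \<epsilon> where "\<epsilon> = G * \<rho> / 2"
  have \<epsilon>: "\<epsilon> > 0" using G \<rho> by (simp add: \<epsilon>_def)
  have "\<exists>\<delta>>0. \<forall>x. x0 - \<delta> < x \<and> x < x0 \<longrightarrow> RL \<beta> g x - RL \<beta> g x0 \<le> \<epsilon> * (x0 - x) powr \<beta>"
  proof (rule RL_increment_small[OF \<beta> x0_pos \<epsilon>])
    show "set_integrable lborel {0<..x0} g" unfolding g_def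
      using \<beta> x0_pos singular_power_kernel(1)[of \<beta> x0] ksub by (intro set_integrable_mult_continuous) auto
    show "continuous_on {0<..} g"
      unfolding g_def by (intro continuous_intros continuous_on_subset[OF k]) auto
    show "set_integrable lborel {0<..x} (\<lambda>r. (x - r) powr (\<beta> - 1) * g r)" if "0 < x" for x
    proof -
      have "set_integrable lborel {0<..x} (\<lambda>r. (x - r) powr (\<beta> - 1) * r powr (- \<beta>))"
        using has_bochner_integral_Beta_kernel[of \<beta> "1 - \<beta>" 0 x] \<beta> that
        by (simp add: set_integrable_def has_bochner_integral_iff)
      then have "set_integrable lborel {0<..x} (\<lambda>r. (x - r) powr (\<beta> - 1) * r powr (- \<beta>) * k r)"
        using ksub by (rule set_integrable_mult_continuous)
      then show ?thesis by (simp add: g_def mult.assoc)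
    qed
  qed
  then obtain d2 where d2: "d2 > 0" "\<And>x. x0 - d2 < x \<Longrightarrow> x < x0 \<Longrightarrow> RL \<beta> g x - RL \<beta> g x0 \<le> \<epsilon> * (x0 - x) powr \<beta>"
    by auto
  define h where "h = min (min d1 d2) x0 / 2"
  have h: "0 < h" "h < d1" "h < d2" "h < x0" using d1(1) d2(1) x0_pos by (auto simp: h_def)
  define x where "x = x0 - h"
  have x: "0 < x" "x < x0" using h by (auto simp: x_def)
  have v_small: "v r \<le> \<epsilon> * (x0 - r) powr \<beta>" if "x < r" "r < x0" for r
    using d2(2)[of r] inv[of r] inv[of x0] that x h by (auto simp: v_def x_def)
  have vsub: "continuous_on {0..z} v" for z unfolding v_def by (intro continuous_intros wsub)
  have kern: "set_integrable lborel {0<..z} (\<lambda>r. (z - r) powr (- \<beta>))"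
    "(LINT r:{0<..z}|lborel. (z - r) powr (- \<beta>)) = z powr (1 - \<beta>) / (1 - \<beta>)" if "0 < z" for z
    using power_kernel[of "1 - \<beta>" 0 z] \<beta> that by auto
  have kv: "set_integrable lborel {0<..z} (\<lambda>r. (z - r) powr (- \<beta>) * v r)" if "0 < z" for z
    by (rule set_integrable_mult_continuous[OF kern(1)[OF that] vsub])
  have Fv: "G * F z = (LINT r:{0<..z}|lborel. (z - r) powr (- \<beta>) * v r)" if "0 < z" for z
  proof -
    have kw: "set_integrable lborel {0<..z} (\<lambda>r. (z - r) powr (- \<beta>) * w r)"
      by (rule set_integrable_mult_continuous[OF kern(1)[OF that] wsub])
    have kc: "set_integrable lborel {0<..z} (\<lambda>r. (z - r) powr (- \<beta>) * w x0)"
      using kern(1)[OF that] by simp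
    have "(LINT r:{0<..z}|lborel. (z - r) powr (- \<beta>) * v r) =
      (LINT r:{0<..z}|lborel. (z - r) powr (- \<beta>) * w r) - (LINT r:{0<..z}|lborel. (z - r) powr (- \<beta>) * w x0)"
      unfolding v_def right_diff_distrib by (rule set_integral_diff(2)[OF kw kc])
    also have "(LINT r:{0<..z}|lborel. (z - r) powr (- \<beta>) * w r) = G * RL (1 - \<beta>) w z"
      unfolding RL_def G_def[symmetric] using G
      by (subst set_integral_mult_right[symmetric]) simp
    also have "(LINT r:{0<..z}|lborel. (z - r) powr (- \<beta>) * w x0) = w x0 * (z powr (1 - \<beta>) / (1 - \<beta>))"
      using kern(2)[OF that] by simp
    finally show ?thesis using G by (simp add: F_def right_diff_distrib)
  qed
  have "G * F x0 = (LINT r:{0<..x}|lborel. (x0 - r) powr (- \<beta>) * v r) + (LINT r:{x<..x0}|lborel. (x0 - r) powr (- \<beta>) * v r)"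
    unfolding Fv[OF x0_pos] by (rule set_integral_Ioc_split[OF kv[OF x0_pos]]) (use x in auto)
  \<comment> \<open>The kernel decreases when its endpoint moves from \<open>x\<close> to
    \<open>x0\<close>, and \<open>v\<close> is nonnegative up to the minimum
    \<open>x0\<close>.\<close>
  moreover have "(LINT r:{0<..x}|lborel. (x0 - r) powr (- \<beta>) * v r) \<le> (LINT r:{0<..x}|lborel. (x - r) powr (- \<beta>) * v r)"
  proof (rule set_integral_mono_interior)
    show "set_integrable lborel {0<..x} (\<lambda>r. (x0 - r) powr (- \<beta>) * v r)"
      by (rule set_integrable_subset[OF kv[OF x0_pos]]) (use x in auto)
    show "(x0 - r) powr (- \<beta>) * v r \<le> (x - r) powr (- \<beta>) * v r" if "0 < r" "r < x" for r
      using that x \<beta> v_nonneg[of r] by (intro mult_right_mono powr_mono2') auto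
  qed (rule kv[OF x(1)])
  moreover have "(LINT r:{x<..x0}|lborel. (x0 - r) powr (- \<beta>) * v r) \<le> (LINT r:{x<..x0}|lborel. \<epsilon>)"
  proof (rule set_integral_mono_interior)
    show "set_integrable lborel {x<..x0} (\<lambda>r. (x0 - r) powr (- \<beta>) * v r)"
      by (rule set_integrable_subset[OF kv[OF x0_pos]]) (use x in auto)
    show "set_integrable lborel {x<..x0} (\<lambda>r. \<epsilon>)"
      by (rule set_integrable_subset[of _ "{x..x0}"]) (auto intro!: borel_integrable_atLeastAtMost')
    \<comment> \<open>The bound on \<open>v\<close> cancels the singular kernel, leaving the
      constant \<open>\<epsilon>\<close> over an interval of length \<open>h\<close>.\<close>
    fix r assume r: "x < r" "r < x0"
    have "(x0 - r) powr (- \<beta>) * v r \<le> (x0 - r) powr (- \<beta>) * (\<epsilon> * (x0 - r) powr \<beta>)"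
      using v_small[OF r] by (intro mult_left_mono) auto
    also have "\<dots> = \<epsilon> * ((x0 - r) powr (- \<beta>) * (x0 - r) powr \<beta>)" by simp
    also have "(x0 - r) powr (- \<beta>) * (x0 - r) powr \<beta> = 1"
      using r by (simp add: powr_add[symmetric])
    finally show "(x0 - r) powr (- \<beta>) * v r \<le> \<epsilon>" by simp
  qed
  moreover have "(LINT r:{x<..x0}|lborel. \<epsilon>) = h * \<epsilon>"
    using x by (subst set_integral_const) (auto simp: x_def)
  ultimately have "G * F x0 - G * F x \<le> h * \<epsilon>"
    using Fv[OF x(1)] by linarith
  then have "G * (F x0 - F x) \<le> G * (\<rho> / 2 * h)"
    by (simp add: \<epsilon>_def algebra_simps)
  then have "F x0 - F x \<le> \<rho> / 2 * h" using G by simp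
  moreover have "\<rho> / 2 * (x0 - h) = \<rho> / 2 * x0 - \<rho> / 2 * h" by (rule right_diff_distrib)
  ultimately show False using d1(2)[OF h(1,2)] unfolding x_def by linarith
qed

section \<open>Solutions on the half-line: sign, uniqueness, monotonicity\<close>

lemma RL_diff:
  assumes "0 < a" "continuous_on {0..} f" "continuous_on {0..} g" "0 < x"
  shows "RL a (\<lambda>r. f r - g r) x = RL a f x - RL a g x"
proof -
  have "set_integrable lborel {0<..x} (\<lambda>r. (x - r) powr (a - 1) / Gamma a * f r)" if "continuous_on {0..} f" for f
    using power_kernel(1)[of a 0 x] assms(1,4) continuous_on_subset[OF that, of "{0..x}"]
    by (intro set_integrable_mult_continuous set_integrable_divide) auto
  from set_integral_diff(2)[OF this[OF assms(2)] this[OF assms(3)]]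
  show ?thesis unfolding RL_def right_diff_distrib .
qed

text \<open>The local term of the censored derivative is moved to the right, so that the derivative
  is \<open>x powr (- \<beta>)\<close> times a continuous function, as \<open>RL_comparison\<close>
  expects. The initial value is left out so that differences of solutions are again
  solutions.\<close>

definition global_solution :: "real \<Rightarrow> real \<Rightarrow> real \<Rightarrow> (real \<Rightarrow> real) \<Rightarrow> bool" where
  "global_solution \<beta> \<alpha> lam u \<longleftrightarrow> continuous_on {0..} u \<and>
    (\<forall>x>0. (RL (1 - \<beta>) u has_real_derivative
      x powr (- \<beta>) * ((1 / Gamma (1 - \<beta>) + lam * x powr \<alpha>) * u x)) (at x))"

text \<open>Each \<open>x\<close> is treated on the interval with \<open>T = x + 1\<close>, where it
  is interior, so the derivative within \<open>{0<..T}\<close> is the two-sided one.\<close>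

lemma solves_imp_global_solution:
  assumes "solves \<beta> \<alpha> lam u0 u"
  shows "global_solution \<beta> \<alpha> lam u" "u 0 = u0"
proof -
  have T: "solves_on \<beta> \<alpha> lam u0 T u" if "T > 0" for T
    using assms that by (auto simp: solves_def)
  show "u 0 = u0" using T[of 1] by (simp add: solves_on_def)
  have "continuous (at x within {0..}) u" if "0 \<le> x" for x
  proof -
    have "continuous_on {0..x + 1} u"
      using T[of "x + 1"] that by (simp add: solves_on_def C_beta_closed_def)
    then have "continuous (at x within {0..x + 1}) u"
      using that by (simp add: continuous_on_eq_continuous_within)
    moreover have "at x within {0..x + 1} = at x within {0..}"
      by (rule at_within_nhd[of x "{..<x + 1}"]) auto
    ultimately show ?thesis by simp
  qed
  moreover have "(RL (1 - \<beta>) u has_real_derivative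
      x powr (- \<beta>) * ((1 / Gamma (1 - \<beta>) + lam * x powr \<alpha>) * u x)) (at x)" if x: "0 < x" for x
  proof -
    have sol: "solves_on \<beta> \<alpha> lam u0 (x + 1) u" using T[of "x + 1"] x by simp
    then have "RL_J \<beta> u \<in> C1_on (x + 1)"
      by (simp add: solves_on_def C_beta_closed_def C_beta_open_def)
    then obtain f' where "\<forall>y\<in>{0<..x + 1}. (RL_J \<beta> u has_vector_derivative f' y) (at y within {0<..x + 1})"
      by (auto simp: C1_on_def)
    then have "(RL_J \<beta> u has_vector_derivative f' x) (at x within {0<..x + 1})"
      using x by simp
    moreover have within: "at x within {0<..x + 1} = at x"
      by (rule at_within_nhd[of x "{0<..<x + 1}"]) (use x in auto)
    ultimately have d: "(RL_J \<beta> u has_vector_derivative f' x) (at x)" by simp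
    then have "vector_derivative (RL_J \<beta> u) (at x within {0<..x + 1}) = f' x"
      unfolding within by (rule vector_derivative_at)
    moreover have "censored_deriv \<beta> (x + 1) u x = lam * x powr (\<alpha> - \<beta>) * u x"
      using sol x by (auto simp: solves_on_def)
    moreover have "x powr (\<alpha> - \<beta>) = x powr (- \<beta>) * x powr \<alpha>"
      by (simp add: powr_add[symmetric])
    ultimately have "f' x = x powr (- \<beta>) * ((1 / Gamma (1 - \<beta>) + lam * x powr \<alpha>) * u x)"
      by (simp add: censored_deriv_def algebra_simps)
    then show ?thesis
      using d by (simp add: has_real_derivative_iff_has_vector_derivative RL_J_eq_RL)
  qed
  ultimately show "global_solution \<beta> \<alpha> lam u"
    by (auto simp: global_solution_def continuous_on_eq_continuous_within)
qed

lemma continuous_on_powr_nonneg: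
  fixes p :: real
  assumes "p > 0"
  shows "continuous_on {0..} (\<lambda>x. x powr p)"
  using assms by (intro continuous_on_powr' continuous_intros) auto

context
  fixes \<alpha> \<beta> lam :: real
  assumes \<beta>: "0 < \<beta>" "\<beta> < 1" and \<alpha>: "0 < \<alpha>" and lam: "lam < 0"
begin

text \<open>The censored derivative has the sign of \<open>lam * u x\<close>, which is positive
  where \<open>u\<close> is negative.\<close>

lemma global_solution_nonneg:
  assumes "global_solution \<beta> \<alpha> lam u" "0 \<le> u 0" "0 \<le> x"
  shows "0 \<le> u x"
proof (rule RL_comparison[OF \<beta>, where w = u and k = "\<lambda>x. (1 / Gamma (1 - \<beta>) + lam * x powr \<alpha>) * u x"])
  show "continuous_on {0..} u" using assms by (simp add: global_solution_def)
  then show "continuous_on {0..} (\<lambda>x. (1 / Gamma (1 - \<beta>) + lam * x powr \<alpha>) * u x)"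
    by (intro continuous_intros continuous_on_powr_nonneg \<alpha>)
  show "u y / Gamma (1 - \<beta>) < (1 / Gamma (1 - \<beta>) + lam * y powr \<alpha>) * u y" if "0 < y" "u y < 0" for y
    using that lam mult_neg_neg[of "lam * y powr \<alpha>" "u y"] by (simp add: distrib_right mult_neg_pos)
qed (use assms in \<open>auto simp: global_solution_def\<close>)

text \<open>By linearity both differences are solutions starting at 0, hence both are
  nonnegative.\<close>

lemma global_solution_unique:
  assumes u: "global_solution \<beta> \<alpha> lam u" and v: "global_solution \<beta> \<alpha> lam v"
    and "u 0 = v 0" "0 \<le> x"
  shows "u x = v x"
proof -
  have "0 \<le> f x - g x" if f: "global_solution \<beta> \<alpha> lam f" and g: "global_solution \<beta> \<alpha> lam g"
    and 0: "f 0 = g 0" for f g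
  proof -
    have "global_solution \<beta> \<alpha> lam (\<lambda>x. f x - g x)"
      unfolding global_solution_def
    proof (intro conjI allI impI)
      show "continuous_on {0..} (\<lambda>x. f x - g x)"
        using f g by (auto simp: global_solution_def intro!: continuous_intros)
      fix x :: real assume x: "0 < x"
      have "((\<lambda>y. RL (1 - \<beta>) f y - RL (1 - \<beta>) g y) has_real_derivative
        x powr (- \<beta>) * ((1 / Gamma (1 - \<beta>) + lam * x powr \<alpha>) * (f x - g x))) (at x)"
        using f g x DERIV_diff[of "RL (1 - \<beta>) f" _ x UNIV "RL (1 - \<beta>) g"]
        by (simp add: global_solution_def right_diff_distrib)
      then show "(RL (1 - \<beta>) (\<lambda>x. f x - g x) has_real_derivative
        x powr (- \<beta>) * ((1 / Gamma (1 - \<beta>) + lam * x powr \<alpha>) * (f x - g x))) (at x)"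
        by (rule has_field_derivative_transform_within_open[where S = "{0<..}"])
          (use f g x \<beta> in \<open>auto simp: global_solution_def RL_diff\<close>)
    qed
    then show ?thesis using global_solution_nonneg[of "\<lambda>x. f x - g x" x] 0 \<open>0 \<le> x\<close> by simp
  qed
  from this[OF u v] this[OF v u] show ?thesis using assms by simp
qed

text \<open>The dilate \<open>u (k x)\<close> solves the same equation with the more negative coefficient
  \<open>lam * k powr \<alpha>\<close>, so it lies below \<open>u\<close>.\<close>
lemma global_solution_antimono:
  assumes u: "global_solution \<beta> \<alpha> lam u" and "0 \<le> u 0" and "0 < x" "x \<le> y"
  shows "u y \<le> u x"
proof (cases "x = y")
  case False
  then have xy: "0 < x" "x < y" using assms by auto
  define k where "k = y / x"
  have k: "1 < k" using xy by (simp add: k_def)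
  have uc: "continuous_on {0..} u" using u by (simp add: global_solution_def)
  have uD: "(RL (1 - \<beta>) u has_real_derivative
      z powr (- \<beta>) * ((1 / Gamma (1 - \<beta>) + lam * z powr \<alpha>) * u z)) (at z)" if "0 < z" for z
    using u that by (simp add: global_solution_def)
  have ukc: "continuous_on {0..} (\<lambda>x. u (k * x))"
    using k by (intro continuous_on_compose2[OF uc] continuous_intros) auto
  define K where "K = (\<lambda>x. (1 / Gamma (1 - \<beta>) + lam * x powr \<alpha>) * u x -
      (1 / Gamma (1 - \<beta>) + lam * (k powr \<alpha> * x powr \<alpha>)) * u (k * x))"
  have "0 \<le> u x - u (k * x)"
  proof (rule RL_comparison[OF \<beta>, where w = "\<lambda>x. u x - u (k * x)" and k = K])
    show "continuous_on {0..} (\<lambda>x. u x - u (k * x))" by (intro continuous_intros uc ukc)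
    show "continuous_on {0..} K"
      unfolding K_def by (intro continuous_intros continuous_on_powr_nonneg \<alpha> uc ukc)
    show "0 \<le> u 0 - u (k * 0)" by simp
    show "(u z - u (k * z)) / Gamma (1 - \<beta>) < K z" if "0 < z" "u z - u (k * z) < 0" for z
    proof -
      \<comment> \<open>The difference of the two sides is
        \<open>lam * z powr \<alpha> * (u z - k powr \<alpha> * u (k * z))\<close>, and the bracket
        is negative because
        \<open>u z < u (k * z) \<le> k powr \<alpha> * u (k * z)\<close>.\<close>
      have "0 \<le> u (k * z)" using global_solution_nonneg[OF u \<open>0 \<le> u 0\<close>, of "k * z"] that k by simp
      moreover have "1 \<le> k powr \<alpha>" using k \<alpha> by (simp add: ge_one_powr_ge_zero)
      ultimately have "u (k * z) \<le> k powr \<alpha> * u (k * z)"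
        using mult_right_mono[of 1 "k powr \<alpha>" "u (k * z)"] by simp
      then have "0 < (lam * z powr \<alpha>) * (u z - k powr \<alpha> * u (k * z))"
        using that lam by (intro mult_neg_neg mult_neg_pos) auto
      then show ?thesis by (simp add: K_def algebra_simps diff_divide_distrib)
    qed
    show "(RL (1 - \<beta>) (\<lambda>x. u x - u (k * x)) has_real_derivative z powr (- \<beta>) * K z) (at z)" if z: "0 < z" for z
    proof -
      have "((\<lambda>x. RL (1 - \<beta>) u (k * x)) has_real_derivative
        ((k * z) powr (- \<beta>) * ((1 / Gamma (1 - \<beta>) + lam * (k * z) powr \<alpha>) * u (k * z))) * k) (at z)"
        by (rule DERIV_chain2[OF uD]) (use k z in \<open>auto intro!: derivative_eq_intros\<close>)
      \<comment> \<open>By \<open>RL_scale\<close>,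
        \<open>k powr (\<beta> - 1) * RL (1 - \<beta>) u (k * x)\<close> is the fractional integral
        of the dilate at \<open>x\<close>.\<close>
      then have "((\<lambda>x. RL (1 - \<beta>) u x - k powr (\<beta> - 1) * RL (1 - \<beta>) u (k * x)) has_real_derivative
        z powr (- \<beta>) * ((1 / Gamma (1 - \<beta>) + lam * z powr \<alpha>) * u z) - k powr (\<beta> - 1) *
        (((k * z) powr (- \<beta>) * ((1 / Gamma (1 - \<beta>) + lam * (k * z) powr \<alpha>) * u (k * z))) * k)) (at z)"
        by (intro DERIV_diff DERIV_cmult uD z)
      also have "k powr (\<beta> - 1) *
        (((k * z) powr (- \<beta>) * ((1 / Gamma (1 - \<beta>) + lam * (k * z) powr \<alpha>) * u (k * z))) * k)
        = (k powr (\<beta> - 1) * k powr (- \<beta>) * k) * (z powr (- \<beta>) * ((1 / Gamma (1 - \<beta>) + lam * (k powr \<alpha> * z powr \<alpha>)) * u (k * z)))"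
        using k z by (simp add: powr_mult)
      also have "k powr (\<beta> - 1) * k powr (- \<beta>) * k = 1"
        using k powr_add[of k "-1" 1] by (simp add: powr_add[symmetric])
      finally have "((\<lambda>x. RL (1 - \<beta>) u x - k powr (\<beta> - 1) * RL (1 - \<beta>) u (k * x)) has_real_derivative z powr (- \<beta>) * K z) (at z)"
        by (simp add: K_def right_diff_distrib)
      then show ?thesis
      proof (rule has_field_derivative_transform_within_open[where S = "{0<..}"])
        fix x :: real assume "x \<in> {0<..}"
        then have "RL (1 - \<beta>) (\<lambda>x. u x - u (k * x)) x = RL (1 - \<beta>) u x - RL (1 - \<beta>) (\<lambda>x. u (k * x)) x"
          using \<beta> by (intro RL_diff uc ukc) auto
        moreover have "k powr (\<beta> - 1) * RL (1 - \<beta>) u (k * x) = (k powr (\<beta> - 1) * k powr (1 - \<beta>)) * RL (1 - \<beta>) (\<lambda>x. u (k * x)) x"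
          using k by (simp add: RL_scale)
        moreover have "k powr (\<beta> - 1) * k powr (1 - \<beta>) = 1"
          using k by (simp add: powr_add[symmetric])
        ultimately show "RL (1 - \<beta>) u x - k powr (\<beta> - 1) * RL (1 - \<beta>) u (k * x) = RL (1 - \<beta>) (\<lambda>x. u x - u (k * x)) x"
          by simp
      qed (use z in auto)
    qed
  qed (use \<open>0 < x\<close> in simp)
  then show ?thesis using xy by (simp add: k_def)
qed simp

end

section \<open>Two-sided decay\<close>

locale positive_solution =
  fixes \<alpha> \<beta> lam :: real and u :: "real \<Rightarrow> real"
  assumes \<beta>: "0 < \<beta>" "\<beta> < 1" and \<alpha>: "0 < \<alpha>" and lam: "lam < 0"
    and u: "global_solution \<beta> \<alpha> lam u" and u0: "0 < u 0"
begin

section \<open>Comparing the fractional integral \<open>J\<close> with the mass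
  \<open>U\<close>\<close>

definition J :: "real \<Rightarrow> real" where "J = RL (1 - \<beta>) u"
definition U :: "real \<Rightarrow> real" where "U = (\<lambda>x. LINT r:{0<..x}|lborel. u r)"
definition c :: real where "c = 1 / Gamma (1 - \<beta>)"
definition l :: real where "l = - lam"

lemma c_pos: "c > 0" and l_pos: "l > 0"
  using Gamma_real_pos[of "1 - \<beta>"] \<beta> lam by (simp_all add: c_def l_def)

lemma u_continuous: "continuous_on {0..} u"
  using u by (simp add: global_solution_def)

lemma u_nonneg: "0 \<le> x \<Longrightarrow> 0 \<le> u x"
  using global_solution_nonneg[OF \<beta> \<alpha> lam u] u0 by simp

lemma u_antimono: "0 < x \<Longrightarrow> x \<le> y \<Longrightarrow> u y \<le> u x"
  using global_solution_antimono[OF \<beta> \<alpha> lam u] u0 by simp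

lemma J_deriv: "0 < x \<Longrightarrow> (J has_real_derivative x powr (- \<beta>) * ((c - l * x powr \<alpha>) * u x)) (at x)"
  using u by (simp add: global_solution_def J_def c_def l_def)

lemma u_integrable: "set_integrable lborel {0<..x} u"
proof -
  have "set_integrable lborel {0..x} u"
    by (rule borel_integrable_atLeastAtMost') (auto intro: continuous_on_subset[OF u_continuous])
  then show ?thesis by (rule set_integrable_subset) auto
qed

lemma kernel_u_integrable:
  assumes "0 < x"
  shows "set_integrable lborel {0<..x} (\<lambda>r. (x - r) powr (- \<beta>) * u r)"
  using power_kernel(1)[of "1 - \<beta>" 0 x] assms \<beta> continuous_on_subset[OF u_continuous, of "{0..x}"]
  by (intro set_integrable_mult_continuous) auto

lemma J_eq: "J x = c * (LINT r:{0<..x}|lborel. (x - r) powr (- \<beta>) * u r)"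
  unfolding J_def RL_def c_def by (subst set_integral_mult_right[symmetric]) simp

lemma U_nonneg: "0 \<le> U x"
  unfolding U_def set_lebesgue_integral_def
  by (intro Bochner_Integration.integral_nonneg) (auto simp: indicator_def u_nonneg)

lemma U_mono: "0 \<le> x \<Longrightarrow> x \<le> y \<Longrightarrow> U x \<le> U y"
proof -
  assume "0 \<le> x" "x \<le> y"
  then have "U y = U x + (LINT r:{x<..y}|lborel. u r)"
    unfolding U_def by (intro set_integral_Ioc_split u_integrable)
  moreover have "0 \<le> (LINT r:{x<..y}|lborel. u r)"
    unfolding set_lebesgue_integral_def using \<open>0 \<le> x\<close>
    by (intro Bochner_Integration.integral_nonneg) (auto simp: indicator_def u_nonneg)
  ultimately show "U x \<le> U y" by simp
qed

lemma U_deriv: "0 < x \<Longrightarrow> (U has_real_derivative u x) (at x)"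
  unfolding U_def
  by (intro has_real_derivative_set_integral u_integrable continuous_on_subset[OF u_continuous]) auto

lemma U_pos:
  assumes "0 < x"
  shows "0 < U x"
proof -
  \<comment> \<open>Extending \<open>u\<close> to the left by the constant \<open>u 0\<close> turns
    one-sided continuity at 0 into \<open>isCont\<close>, so \<open>u\<close> is positive at some
    \<open>y > 0\<close>; by monotonicity the mass is at least \<open>y * u y\<close>.\<close>
  have "continuous_on UNIV (\<lambda>x. u (max 0 x))"
    by (rule continuous_on_compose2[OF u_continuous]) (auto intro!: continuous_intros)
  then have "isCont (\<lambda>x. u (max 0 x)) 0"
    by (simp add: continuous_on_eq_continuous_at)
  then have "\<forall>\<^sub>F y in at 0. 0 < u (max 0 y)"
    unfolding isCont_def using u0 by (intro order_tendstoD(1)) auto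
  then obtain d where d: "d > 0" "\<And>y. \<bar>y\<bar> < d \<Longrightarrow> y \<noteq> 0 \<Longrightarrow> 0 < u (max 0 y)"
    by (auto simp: eventually_at dist_real_def)
  define y where "y = min x (d / 2)"
  have y: "0 < y" "y \<le> x" "0 < u y" using d(1) d(2)[of y] assms by (auto simp: y_def)
  have "y * u y = (LINT r:{0<..y}|lborel. u y)"
    using y by (subst set_integral_const) auto
  also have "\<dots> \<le> U y" unfolding U_def
    by (rule set_integral_mono)
      (auto intro!: u_integrable u_antimono set_integrable_subset[OF borel_integrable_atLeastAtMost', of 0 y])
  also have "\<dots> \<le> U x" using y by (intro U_mono) auto
  finally show ?thesis using y mult_pos_pos[of y "u y"] by linarith
qed

text \<open>The kernel increases in \<open>r\<close>, so it is at least its value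
  \<open>x powr (- \<beta>)\<close> at \<open>r = 0\<close>.\<close>

lemma J_lower:
  assumes "0 < x"
  shows "c * (x powr (- \<beta>) * U x) \<le> J x"
proof -
  have "x powr (- \<beta>) * U x = (LINT r:{0<..x}|lborel. x powr (- \<beta>) * u r)"
    unfolding U_def by simp
  also have "\<dots> \<le> (LINT r:{0<..x}|lborel. (x - r) powr (- \<beta>) * u r)"
    using \<beta> assms
    by (intro set_integral_mono_interior kernel_u_integrable mult_right_mono powr_mono2' u_nonneg)
      (auto intro: u_integrable)
  finally show ?thesis unfolding J_eq using c_pos by simp
qed

text \<open>Chebyshev's integral inequality for the increasing kernel and the decreasing \<open>u\<close>; \<open>s\<close> is
  the point where the kernel equals its mean.\<close>
lemma J_upper:
  assumes "0 < x"
  shows "J x \<le> c / (1 - \<beta>) * (x powr (- \<beta>) * U x)"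
proof -
  \<comment> \<open>\<open>\<theta>\<close> solves
    \<open>\<theta> powr (- \<beta>) = 1 / (1 - \<beta>)\<close>; it is the distance from
    \<open>x\<close>, relative to \<open>x\<close>, at which the kernel equals its mean
    \<open>m\<close>.\<close>
  define \<theta> where "\<theta> = (1 - \<beta>) powr (1 / \<beta>)"
  have \<theta>: "0 < \<theta>" "\<theta> < 1"
    using \<beta> powr_less_mono2[of "1 / \<beta>" "1 - \<beta>" 1] by (auto simp: \<theta>_def)
  define s where "s = x - x * \<theta>"
  have s: "0 < s" "s < x" using \<theta> assms by (auto simp: s_def)
  define m where "m = x powr (- \<beta>) / (1 - \<beta>)"
  have ms: "(x - s) powr (- \<beta>) = m"
  proof -
    have "\<theta> powr (- \<beta>) = 1 / (1 - \<beta>)"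
      using \<beta> by (simp add: \<theta>_def powr_powr powr_minus_divide)
    then show ?thesis using assms \<theta> by (simp add: s_def powr_mult m_def)
  qed
  have ki: "set_integrable lborel {0<..x} (\<lambda>r. (x - r) powr (- \<beta>))"
    and k: "(LINT r:{0<..x}|lborel. (x - r) powr (- \<beta>)) = x * m"
    using power_kernel[of "1 - \<beta>" 0 x] assms \<beta> powr_add[of x 1 "- \<beta>"] by (auto simp: m_def)
  have mi: "set_integrable lborel {0<..x} (\<lambda>r. m)"
    by (rule set_integrable_subset[of _ "{0..x}"]) (auto intro!: borel_integrable_atLeastAtMost')
  have i1: "set_integrable lborel {0<..x} (\<lambda>r. m * u r)" using u_integrable by simp
  have i2: "set_integrable lborel {0<..x} (\<lambda>r. u s * ((x - r) powr (- \<beta>) - m))"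
    using set_integral_diff(1)[OF ki mi] by simp
  have "(LINT r:{0<..x}|lborel. (x - r) powr (- \<beta>) * u r)
    \<le> (LINT r:{0<..x}|lborel. m * u r + u s * ((x - r) powr (- \<beta>) - m))"
  proof (rule set_integral_mono_interior[OF kernel_u_integrable[OF assms] set_integral_add(1)[OF i1 i2]])
    fix r assume r: "0 < r" "r < x"
    have "((x - r) powr (- \<beta>) - m) * (u r - u s) \<le> 0"
    proof (cases "r \<le> s")
      case True
      then have "(x - r) powr (- \<beta>) \<le> m" "u s \<le> u r"
        unfolding ms[symmetric] using s r \<beta> by (auto intro: powr_mono2' u_antimono)
      then show ?thesis by (intro mult_nonpos_nonneg) auto
    next
      case False
      then have "m \<le> (x - r) powr (- \<beta>)" "u r \<le> u s"
        unfolding ms[symmetric] using s r \<beta> by (auto intro: powr_mono2' u_antimono)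
      then show ?thesis by (intro mult_nonneg_nonpos) auto
    qed
    then show "(x - r) powr (- \<beta>) * u r \<le> m * u r + u s * ((x - r) powr (- \<beta>) - m)"
      by (simp add: algebra_simps)
  qed
  \<comment> \<open>The correction term integrates to zero, since the kernel and the constant
    \<open>m\<close> both have integral \<open>x * m\<close>.\<close>
  also have "\<dots> = m * U x + u s * (x * m - x * m)"
    unfolding set_integral_add(2)[OF i1 i2] set_integral_mult_right set_integral_diff(2)[OF ki mi] k U_def
    using assms by (subst set_integral_const) auto
  finally have "c * (LINT r:{0<..x}|lborel. (x - r) powr (- \<beta>) * u r) \<le> c * (m * U x)"
    using c_pos by (intro mult_left_mono) auto
  then show ?thesis unfolding J_eq by (simp add: m_def)
qed

section \<open>Decay rates read off from the drop of \<open>J\<close>\<close>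

lemma J_mvt:
  assumes "0 < x" "x < y"
  obtains \<xi> where "x < \<xi>" "\<xi> < y" "J x - J y = (y - x) * (\<xi> powr (- \<beta>) * ((l * \<xi> powr \<alpha> - c) * u \<xi>))"
proof -
  obtain \<xi> where "x < \<xi>" "\<xi> < y" "J y - J x = (y - x) * (\<xi> powr (- \<beta>) * ((c - l * \<xi> powr \<alpha>) * u \<xi>))"
    using MVT2[of x y J "\<lambda>x. x powr (- \<beta>) * ((c - l * x powr \<alpha>) * u x)"] J_deriv assms by auto
  then show ?thesis using that[of \<xi>] by (simp add: algebra_simps)
qed

lemma decay_by_integral:
  obtains K R where "0 < K" "1 \<le> R" "\<And>y. R \<le> y \<Longrightarrow> u y \<le> K * y powr (- 1 - \<alpha>) * U y"
proof -
  \<comment> \<open>Beyond \<open>R\<close> one has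
    \<open>2 * c \<le> l * \<xi> powr \<alpha>\<close>, so subtracting \<open>c\<close> costs at
    most half of the decay coefficient.\<close>
  define R where "R = max 1 ((2 * c / l) powr (1 / \<alpha>))"
  have R: "2 * c \<le> l * \<xi> powr \<alpha>" if "R \<le> \<xi>" for \<xi>
  proof -
    have "2 * c / l = ((2 * c / l) powr (1 / \<alpha>)) powr \<alpha>"
      using c_pos l_pos \<alpha> by (simp add: powr_powr)
    also have "\<dots> \<le> \<xi> powr \<alpha>" using that \<alpha> by (intro powr_mono2) (auto simp: R_def)
    finally show ?thesis using l_pos by (simp add: field_simps)
  qed
  \<comment> \<open>\<open>c / (1 - \<beta>)\<close> comes from \<open>J_upper\<close>,
    \<open>2 / l\<close> from the halved coefficient, \<open>2 powr \<beta>\<close> from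
    \<open>(2 * x) powr (- \<beta>)\<close>.\<close>
  define K where "K = c / (1 - \<beta>) * 2 / l * 2 powr \<beta>"
  have K: "K > 0" using c_pos l_pos \<beta> by (simp add: K_def)
  have main: "u (2 * x) \<le> K * x powr (- 1 - \<alpha>) * U x" if x: "R \<le> x" for x
  proof -
    have x_pos: "0 < x" using x by (auto simp: R_def)
    obtain \<xi> where \<xi>: "x < \<xi>" "\<xi> < 2 * x"
      "J x - J (2 * x) = (2 * x - x) * (\<xi> powr (- \<beta>) * ((l * \<xi> powr \<alpha> - c) * u \<xi>))"
      using J_mvt[of x "2 * x"] x_pos by auto
    have "l / 2 * x powr \<alpha> \<le> l / 2 * \<xi> powr \<alpha>"
      using \<xi> x_pos \<alpha> l_pos by (intro mult_left_mono powr_mono2) auto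
    also have "\<dots> \<le> l * \<xi> powr \<alpha> - c" using R[of \<xi>] x \<xi> by simp
    finally have 1: "l / 2 * x powr \<alpha> \<le> l * \<xi> powr \<alpha> - c" .
    have 2: "(2 * x) powr (- \<beta>) \<le> \<xi> powr (- \<beta>)"
      using \<xi> x_pos \<beta> by (intro powr_mono2') auto
    have "x * ((2 * x) powr (- \<beta>) * ((l / 2 * x powr \<alpha>) * u (2 * x))) \<le> J x - J (2 * x)"
      unfolding \<xi>(3) using 1 2 x_pos \<xi> l_pos c_pos
      by (intro mult_mono u_antimono mult_nonneg_nonneg u_nonneg order_trans[OF _ 1]) auto
    also have "\<dots> \<le> J x"
    proof -
      have "0 \<le> c * ((2 * x) powr (- \<beta>) * U (2 * x))"
        using c_pos U_nonneg by (intro mult_nonneg_nonneg) auto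
      then show ?thesis using J_lower[of "2 * x"] x_pos by simp
    qed
    also have "\<dots> \<le> c / (1 - \<beta>) * (x powr (- \<beta>) * U x)" by (rule J_upper[OF x_pos])
    finally have "x powr (- \<beta>) * (l / 2 * 2 powr (- \<beta>) * (x * x powr \<alpha>) * u (2 * x))
      \<le> x powr (- \<beta>) * (c / (1 - \<beta>) * U x)"
      using x_pos by (simp add: powr_mult mult_ac)
    then have *: "l / 2 * 2 powr (- \<beta>) * (x * x powr \<alpha>) * u (2 * x) \<le> c / (1 - \<beta>) * U x"
      by (rule mult_left_le_imp_le) (use x_pos in simp)
    have "u (2 * x) = (2 / l * 2 powr \<beta> * x powr (- 1 - \<alpha>)) * (l / 2 * 2 powr (- \<beta>) * (x * x powr \<alpha>) * u (2 * x))"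
    proof -
      have "x powr (- 1 - \<alpha>) * (x * x powr \<alpha>) = 1"
        using x_pos powr_add[of x 1 \<alpha>] powr_add[of x "- 1 - \<alpha>" "1 + \<alpha>"] by simp
      moreover have "2 powr \<beta> * 2 powr (- \<beta>) = (1::real)" by (simp add: powr_add[symmetric])
      moreover have "2 / l * (l / 2) = 1" using l_pos by simp
      moreover have "(2 / l * 2 powr \<beta> * x powr (- 1 - \<alpha>)) * (l / 2 * 2 powr (- \<beta>) * (x * x powr \<alpha>) * u (2 * x))
        = (2 / l * (l / 2)) * (2 powr \<beta> * 2 powr (- \<beta>)) * (x powr (- 1 - \<alpha>) * (x * x powr \<alpha>)) * u (2 * x)"
        by (simp only: mult_ac)
      ultimately show ?thesis by simp
    qed
    also have "\<dots> \<le> (2 / l * 2 powr \<beta> * x powr (- 1 - \<alpha>)) * (c / (1 - \<beta>) * U x)"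
      using * l_pos by (intro mult_left_mono) auto
    finally show ?thesis by (simp add: K_def mult_ac)
  qed
  \<comment> \<open>With \<open>y = 2 * x\<close> and \<open>U (y / 2) \<le> U y\<close>, both sides
    refer to the same point, as a differential inequality for \<open>U\<close> requires.\<close>
  have "u y \<le> K * 2 powr (1 + \<alpha>) * y powr (- 1 - \<alpha>) * U y" if y: "2 * R \<le> y" for y
  proof -
    have y_pos: "0 < y" using y by (auto simp: R_def)
    have "u y \<le> K * (y / 2) powr (- 1 - \<alpha>) * U (y / 2)" using main[of "y / 2"] y by simp
    also have "(y / 2) powr (- 1 - \<alpha>) = 2 powr (1 + \<alpha>) * y powr (- 1 - \<alpha>)"
      using y_pos powr_minus_divide[of 2 "1 + \<alpha>"] by (simp add: powr_divide)
    also have "K * (2 powr (1 + \<alpha>) * y powr (- 1 - \<alpha>)) * U (y / 2) \<le> K * (2 powr (1 + \<alpha>) * y powr (- 1 - \<alpha>)) * U y"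
      using y_pos K by (intro mult_left_mono U_mono) auto
    finally show ?thesis by (simp add: mult_ac)
  qed
  moreover have "1 \<le> 2 * R" by (auto simp: R_def)
  moreover have "0 < K * 2 powr (1 + \<alpha>)" using K by simp
  ultimately show ?thesis using that by blast
qed

text \<open>Gronwall's argument, with the integrating factor \<open>exp (K * y powr (- \<alpha>) / \<alpha>)\<close>.\<close>
lemma U_bounded:
  obtains B where "0 < B" "\<And>x. 0 < x \<Longrightarrow> U x \<le> B"
proof -
  obtain K R where KR: "0 < K" "1 \<le> R" "\<And>y. R \<le> y \<Longrightarrow> u y \<le> K * y powr (- 1 - \<alpha>) * U y"
    using decay_by_integral by blast
  define E where "E = (\<lambda>y. U y * exp (K * y powr (- \<alpha>) / \<alpha>))"
  have UE: "U y \<le> E y" for y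
    using mult_left_mono[of 1 "exp (K * y powr (- \<alpha>) / \<alpha>)" "U y"] KR(1) \<alpha> U_nonneg[of y]
    by (simp add: E_def)
  have "E y \<le> E R" if "R \<le> y" for y
  proof (rule DERIV_nonpos_imp_nonincreasing[OF that])
    fix x assume x: "R \<le> x" "x \<le> y"
    then have x_pos: "0 < x" using KR(2) by simp
    have "((\<lambda>y. exp (K * y powr (- \<alpha>) / \<alpha>)) has_real_derivative
      exp (K * x powr (- \<alpha>) / \<alpha>) * - (K * x powr (- \<alpha> - 1))) (at x)"
      using x_pos \<alpha> by (auto intro!: derivative_eq_intros)
    moreover have "- \<alpha> - 1 = - 1 - \<alpha>" by simp
    ultimately have "((\<lambda>y. exp (K * y powr (- \<alpha>) / \<alpha>)) has_real_derivative
      exp (K * x powr (- \<alpha>) / \<alpha>) * - (K * x powr (- 1 - \<alpha>))) (at x)" by (simp only:)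
    from DERIV_mult[OF U_deriv[OF x_pos] this]
    have "(E has_real_derivative (u x - K * x powr (- 1 - \<alpha>) * U x) * exp (K * x powr (- \<alpha>) / \<alpha>)) (at x)"
      unfolding E_def by (rule DERIV_cong) (simp only: left_diff_distrib, simp)
    moreover have "(u x - K * x powr (- 1 - \<alpha>) * U x) * exp (K * x powr (- \<alpha>) / \<alpha>) \<le> 0"
      using KR(3)[OF x(1)] by (intro mult_nonpos_nonneg) auto
    ultimately show "\<exists>d. (E has_real_derivative d) (at x) \<and> d \<le> 0" by blast
  qed
  then have "E (max x R) \<le> E R" for x by simp
  then have "U x \<le> E R" if "0 < x" for x
    using order_trans[OF U_mono[of x "max x R"] UE[of "max x R"]] that
    by (intro order_trans[OF _ \<open>E (max x R) \<le> E R\<close>]) simp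
  moreover have "0 < E R" using U_pos[of R] UE[of R] KR(2) by linarith
  ultimately show ?thesis using that by blast
qed

lemma upper_bound:
  obtains C where "\<And>x. 1 \<le> x \<Longrightarrow> u x \<le> C / x powr (1 + \<alpha>)"
proof -
  obtain K R where KR: "0 < K" "1 \<le> R" "\<And>y. R \<le> y \<Longrightarrow> u y \<le> K * y powr (- 1 - \<alpha>) * U y"
    using decay_by_integral by blast
  obtain B where B: "0 < B" "\<And>x. 0 < x \<Longrightarrow> U x \<le> B" using U_bounded by blast
  \<comment> \<open>The second entry covers \<open>{1..R}\<close>, where
    \<open>u x \<le> u 1\<close> and \<open>x \<le> R\<close>.\<close>
  define C where "C = max (K * B) (u 1 * R powr (1 + \<alpha>))"
  have "u x \<le> C / x powr (1 + \<alpha>)" if x: "1 \<le> x" for x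
  proof -
    have p: "x powr (- 1 - \<alpha>) = 1 / x powr (1 + \<alpha>)"
      using powr_minus_divide[of x "1 + \<alpha>"] by simp
    show ?thesis
    proof (cases "R \<le> x")
      case True
      have "u x \<le> K * x powr (- 1 - \<alpha>) * U x" by (rule KR(3)[OF True])
      also have "\<dots> \<le> K * x powr (- 1 - \<alpha>) * B"
        using B x KR(1) by (intro mult_left_mono) auto
      also have "\<dots> = K * B / x powr (1 + \<alpha>)" by (simp add: p)
      also have "\<dots> \<le> C / x powr (1 + \<alpha>)" by (intro divide_right_mono) (auto simp: C_def)
      finally show ?thesis .
    next
      case False
      have "u x * x powr (1 + \<alpha>) \<le> u 1 * R powr (1 + \<alpha>)"
        using x False \<alpha> by (intro mult_mono u_antimono powr_mono2 u_nonneg) auto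
      also have "\<dots> \<le> C" by (simp add: C_def)
      finally show ?thesis using x by (simp add: le_divide_eq)
    qed
  qed
  then show ?thesis using that by blast
qed

text \<open>\<open>J x\<close> is at least a multiple of \<open>x powr (- \<beta>)\<close>, while
  the bound for \<open>J (M * x)\<close> carries an extra \<open>M powr (- \<beta>)\<close>. For
  large \<open>M\<close> a fixed share of the former is lost between \<open>x\<close> and
  \<open>M * x\<close>, and by monotonicity \<open>u x\<close> controls that loss.\<close>

lemma lower_bound:
  obtains C where "0 < C" "\<And>x. 1 \<le> x \<Longrightarrow> C / x powr (1 + \<alpha>) \<le> u x"
proof -
  obtain B where B: "0 < B" "\<And>x. 0 < x \<Longrightarrow> U x \<le> B" using U_bounded by blast
  have U1: "0 < U 1" by (rule U_pos) simp
  \<comment> \<open>\<open>A \<le> M powr \<beta>\<close> is the condition for the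
    \<open>J_upper\<close> bound at \<open>M * x\<close>, with \<open>B\<close> for
    \<open>U\<close>, to be at most half of the \<open>J_lower\<close> bound at \<open>x\<close>,
    with \<open>U 1\<close> for \<open>U x\<close>.\<close>
  define A where "A = 2 * B / ((1 - \<beta>) * U 1)"
  have A: "A > 0" using B U1 \<beta> by (simp add: A_def)
  define M where "M = max 2 (A powr (1 / \<beta>))"
  have M: "1 < M" by (simp add: M_def)
  have "A \<le> M powr \<beta>"
  proof -
    have "A = (A powr (1 / \<beta>)) powr \<beta>" using A \<beta> by (simp add: powr_powr)
    also have "\<dots> \<le> M powr \<beta>" using \<beta> by (intro powr_mono2) (auto simp: M_def)
    finally show ?thesis .
  qed
  then have MB: "1 / (1 - \<beta>) * (M powr (- \<beta>) * B) \<le> U 1 / 2"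
    using M \<beta> U1 by (simp add: A_def powr_minus_divide field_simps)
  define C where "C = c * U 1 / 2 / ((M - 1) * l * M powr \<alpha>)"
  have C: "C > 0" using c_pos U1 M l_pos by (simp add: C_def)
  have "C / x powr (1 + \<alpha>) \<le> u x" if x: "1 \<le> x" for x
  proof -
    have x_pos: "0 < x" using x by simp
    obtain \<xi> where \<xi>: "x < \<xi>" "\<xi> < M * x"
      "J x - J (M * x) = (M * x - x) * (\<xi> powr (- \<beta>) * ((l * \<xi> powr \<alpha> - c) * u \<xi>))"
      using J_mvt[of x "M * x"] x_pos M by auto
    have "J (M * x) \<le> c / (1 - \<beta>) * ((M * x) powr (- \<beta>) * U (M * x))"
      using x_pos M by (intro J_upper) auto
    also have "\<dots> \<le> c / (1 - \<beta>) * ((M * x) powr (- \<beta>) * B)"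
      using x_pos M c_pos \<beta> B by (intro mult_left_mono) auto
    also have "\<dots> = c * x powr (- \<beta>) * (1 / (1 - \<beta>) * (M powr (- \<beta>) * B))"
      using x_pos M by (simp add: powr_mult)
    also have "\<dots> \<le> c * x powr (- \<beta>) * (U 1 / 2)"
      using MB c_pos by (intro mult_left_mono) auto
    finally have J2: "J (M * x) \<le> c * x powr (- \<beta>) * (U 1 / 2)" .
    have "c * (x powr (- \<beta>) * U 1) \<le> c * (x powr (- \<beta>) * U x)"
      using c_pos x by (intro mult_left_mono U_mono) auto
    also have "\<dots> \<le> J x" by (rule J_lower[OF x_pos])
    finally have "x powr (- \<beta>) * (c * U 1 / 2) \<le> J x - J (M * x)"
      using J2 by (simp add: algebra_simps)
    also have "\<dots> \<le> (M * x - x) * (x powr (- \<beta>) * ((l * (M * x) powr \<alpha>) * u x))"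
    proof -
      \<comment> \<open>Discarding \<open>- c\<close> keeps an upper bound whatever the sign of the
        coefficient, so the estimate holds from \<open>x = 1\<close> on, without a threshold like
        \<open>R\<close>.\<close>
      have "(l * \<xi> powr \<alpha> - c) * u \<xi> \<le> (l * \<xi> powr \<alpha>) * u \<xi>"
        using c_pos u_nonneg[of \<xi>] \<xi> x_pos by (intro mult_right_mono) auto
      also have "\<dots> \<le> (l * (M * x) powr \<alpha>) * u x"
        using l_pos \<xi> x_pos \<alpha> by (intro mult_mono mult_left_mono powr_mono2 u_antimono u_nonneg) auto
      finally have 1: "(l * \<xi> powr \<alpha> - c) * u \<xi> \<le> (l * (M * x) powr \<alpha>) * u x" .
      have "\<xi> powr (- \<beta>) * ((l * \<xi> powr \<alpha> - c) * u \<xi>) \<le> \<xi> powr (- \<beta>) * ((l * (M * x) powr \<alpha>) * u x)"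
        using 1 by (intro mult_left_mono) auto
      also have "\<dots> \<le> x powr (- \<beta>) * ((l * (M * x) powr \<alpha>) * u x)"
        using \<xi> x_pos \<beta> l_pos u_nonneg[of x] by (intro mult_right_mono powr_mono2' mult_nonneg_nonneg) auto
      finally show ?thesis unfolding \<xi>(3) using M x_pos by (intro mult_left_mono) auto
    qed
    also have "\<dots> = x powr (- \<beta>) * (((M - 1) * l * M powr \<alpha>) * (x powr (1 + \<alpha>) * u x))"
      using M x_pos by (simp add: powr_mult powr_add algebra_simps)
    finally have "c * U 1 / 2 \<le> ((M - 1) * l * M powr \<alpha>) * (x powr (1 + \<alpha>) * u x)"
      by (rule mult_left_le_imp_le) (use x_pos in simp)
    then have "C \<le> x powr (1 + \<alpha>) * u x"
      using M l_pos unfolding C_def by (subst pos_divide_le_eq) (auto simp: mult_ac)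
    then show ?thesis using x_pos by (simp add: divide_le_eq mult.commute)
  qed
  then show ?thesis using that C by blast
qed

end

theorem proposition3p24:
  fixes \<alpha> \<beta> lam u0 :: real
  assumes "0 < \<beta>" and "\<beta> < 1" and "\<alpha> > 0" and "lam < 0" and "u0 > 0"
  shows "\<exists>C>1. \<forall>u. solves \<beta> \<alpha> lam u0 u \<longrightarrow>
           (\<forall>x\<ge>1. inverse C / x powr (1 + \<alpha>) \<le> u x \<and> u x \<le> C / x powr (1 + \<alpha>))"
proof (cases "\<exists>u. solves \<beta> \<alpha> lam u0 u")
  case True
  \<comment> \<open>\<open>C\<close> precedes the quantifier over solutions: it is extracted from
    one of them, and uniqueness carries it to every other. Without any solution the claim is
    vacuous.\<close>
  then obtain u where "solves \<beta> \<alpha> lam u0 u" by blast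
  note sol = solves_imp_global_solution[OF this]
  have pos: "0 < u 0" using sol(2) assms by simp
  interpret positive_solution \<alpha> \<beta> lam u
    by unfold_locales (use assms sol(1) pos in auto)
  obtain C1 where C1: "\<And>x. 1 \<le> x \<Longrightarrow> u x \<le> C1 / x powr (1 + \<alpha>)"
    using upper_bound by blast
  obtain C2 where C2: "0 < C2" "\<And>x. 1 \<le> x \<Longrightarrow> C2 / x powr (1 + \<alpha>) \<le> u x"
    using lower_bound by blast
  define C where "C = Max {2, C1, inverse C2}"
  have C: "2 \<le> C" "C1 \<le> C" "inverse C2 \<le> C" by (auto simp: C_def)
  then have "inverse C \<le> C2"
    using C2(1) le_imp_inverse_le[of "inverse C2" C] by simp
  show ?thesis
  proof (intro exI[of _ C] conjI allI impI)
    show "1 < C" using C by simp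
    fix v x assume v: "solves \<beta> \<alpha> lam u0 v" and x: "1 \<le> (x::real)"
    note v = solves_imp_global_solution[OF v]
    have "v x = u x"
      by (rule global_solution_unique[OF assms(1-4) v(1) sol(1) trans[OF v(2) sol(2)[symmetric]]]) (use x in simp)
    moreover have "inverse C / x powr (1 + \<alpha>) \<le> C2 / x powr (1 + \<alpha>)"
      using \<open>inverse C \<le> C2\<close> by (rule divide_right_mono) simp
    moreover have "C1 / x powr (1 + \<alpha>) \<le> C / x powr (1 + \<alpha>)"
      using C(2) by (rule divide_right_mono) simp
    ultimately show "inverse C / x powr (1 + \<alpha>) \<le> v x" "v x \<le> C / x powr (1 + \<alpha>)"
      using C1[OF x] C2(2)[OF x] by linarith+
  qed
qed (auto intro: exI[of _ 2])

end
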